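(* Let $k$ be an algebraically closed field and let $M$ be any affine, reduced affine, periodic or reduced periodic monoid associated to a planar diagram monoid (Temperley--Lieb, Motzkin or planar rook) or to the rook monoid, with group of units $G$. If $V$ is a finite-dimensional $kM$-module on which no nonunit acts invertibly, and such that $\mathrm{Res}_G(V)$ is faithful, then there is $C\in\mathbb R_{>0}$ such that $$C(\dim V)^n\le l(n)\le(\dim V)^n,$$ and moreover $r_n(V)\to1$ as $n\to\infty$, where $r_n(V)$ is the fraction of composition factors of $V^{\otimes n}$ (counted with multiplicity) on which $M\setminus G$ acts as $0$.
   Context: $V^{\otimes n}$ carries the diagonal action of $M$; $l(n)$ is the number of composition factors of the $kM$-module $V^{\otimes n}$, counted with multiplicity. $\mathrm{Res}_G(V)$ is the restriction of $V$ to $G$. Fix $m\ge1$. An affine partition $m$-diagram consists of the strip $\mathbb R\times[0,1]$ with one vertex at each point of $\mathbb Z\times\{0,1\}$ (bottom and top vertices), edges between vertices (at most one between any two) and finitely many horizontal lines (non-contractible loops), invariant under translation by $m$; two diagrams are equal if they induce the same set partition of the vertices and have the same number of non-contractible loops. Diagrams are composed by stacking, identifying the middle vertices, deleting closed (contractible) components, and juxtaposing the non-contractible loops. The affine monoids are: Temperley--Lieb $\overline{aTL_m}$ (planar, i.e. crossing-free, diagrams with all components of size $2$); Motzkin $\overline{aMo_m}$ (planar diagrams with all components of size $\le2$); rook $aRo_m$ (no non-contractible loops, all components with at most one top and at most one bottom vertex); planar rook $aPRo_m$ (planar diagrams in $aRo_m$). The reduced affine monoids consist of the diagrams without non-contractible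 loops, with any non-contractible loops arising in a product deleted. The periodic (resp. reduced periodic) monoids are the submonoids of the affine (resp. reduced affine) ones generated by: $e_i$ for Temperley--Lieb; $e_i,l_i,r_i$ for Motzkin; $l_i,r_i$ for planar rook ($0\le i\le m-1$); $p_1,s_0,\dots,s_{m-1}$ for rook. Here (up to translation by $m$, with vertical lines elsewhere) $e_i$ joins the top vertices $i,i+1$ and the bottom vertices $i,i+1$; $l_i$ joins top $i+1$ to bottom $i$, leaving top $i$ and bottom $i+1$ isolated; $r_i$ joins top $i$ to bottom $i+1$, leaving top $i+1$ and bottom $i$ isolated; $s_i$ crosses strands $i,i+1$; $p_1$ has isolated top and bottom vertices at $1$. *)

theory Defs
  imports
    "HOL-Algebra.Group"
    "HOL-Computational_Algebra.Fundamental_Theorem_Algebra"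
    "HOL-Library.Poly_Mapping"
    Complex_Main
begin

section \<open>Affine diagrams\<close>

text \<open>The vertex \<open>(i, 1)\<close> of the strip is \<open>Top i\<close>, the vertex \<open>(i, 0)\<close> is \<open>Bot i\<close>.\<close>

datatype vertex = Top int | Bot int

primrec shift :: "int \<Rightarrow> vertex \<Rightarrow> vertex" where
  "shift t (Top i) = Top (i + t)"
| "shift t (Bot i) = Bot (i + t)"

text \<open>Diagrams are identified when they induce the same set partition of the vertices and have
  the same number of non-contractible loops. So a diagram is the equivalence relation ``same
  component'' together with that number.\<close>

datatype diagram = Diagram (conn: "(vertex \<times> vertex) set") (loops: nat)

abbreviation components :: "diagram \<Rightarrow> vertex set set" where
  "components D \<equiv> UNIV // conn D"

definition affine_diagram :: "nat \<Rightarrow> diagram \<Rightarrow> bool" where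
  "affine_diagram m D \<longleftrightarrow> equiv UNIV (conn D) \<and>
     (\<forall>u v. (u, v) \<in> conn D \<longleftrightarrow> (shift (int m) u, shift (int m) v) \<in> conn D)"

text \<open>Order of the vertices along the boundary of the strip: the bottom line from left to right,
  then the top line from right to left.\<close>

fun boundary_less :: "vertex \<Rightarrow> vertex \<Rightarrow> bool" where
  "boundary_less (Bot i) (Bot j) \<longleftrightarrow> i < j"
| "boundary_less (Bot i) (Top j) \<longleftrightarrow> True"
| "boundary_less (Top i) (Bot j) \<longleftrightarrow> False"
| "boundary_less (Top i) (Top j) \<longleftrightarrow> j < i"

text \<open>Components of size at most two can be drawn without crossings in the (simply connected)
  strip iff no two of them interleave along its boundary. A horizontal line, which separates the
  top from the bottom, can be added without crossings iff no component joins top to bottom.\<close>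

definition planar :: "diagram \<Rightarrow> bool" where
  "planar D \<longleftrightarrow>
     (\<forall>a b c d. boundary_less a b \<and> boundary_less b c \<and> boundary_less c d \<and>
        (a, c) \<in> conn D \<and> (b, d) \<in> conn D \<longrightarrow> (a, b) \<in> conn D) \<and>
     (loops D > 0 \<longrightarrow> (\<forall>i j. (Top i, Bot j) \<notin> conn D))"

definition rook_diagram :: "diagram \<Rightarrow> bool" where
  "rook_diagram D \<longleftrightarrow> loops D = 0 \<and>
     (\<forall>K\<in>components D. \<forall>i j. (Top i \<in> K \<and> Top j \<in> K \<longrightarrow> i = j) \<and>
                             (Bot i \<in> K \<and> Bot j \<in> K \<longrightarrow> i = j))"


section \<open>Composition\<close>

text \<open>Vertices of a stack of two diagrams, the bottom row of the upper one being identified with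
  the top row of the lower one.\<close>

datatype stack_vertex = Upper int | Middle int | Lower int

primrec upper_part :: "vertex \<Rightarrow> stack_vertex" where
  "upper_part (Top i) = Upper i"
| "upper_part (Bot i) = Middle i"

primrec lower_part :: "vertex \<Rightarrow> stack_vertex" where
  "lower_part (Top i) = Middle i"
| "lower_part (Bot i) = Lower i"

primrec outer :: "vertex \<Rightarrow> stack_vertex" where
  "outer (Top i) = Upper i"
| "outer (Bot i) = Lower i"

definition stack_conn :: "diagram \<Rightarrow> diagram \<Rightarrow> (stack_vertex \<times> stack_vertex) set" where
  "stack_conn D E =
     (map_prod upper_part upper_part ` conn D \<union> map_prod lower_part lower_part ` conn E)\<^sup>*"

text \<open>A component of the stack consisting of middle vertices only is contractible if it is finite;
  in the planar monoids below, an infinite one is a line running through the whole strip, that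
  is, a non-contractible loop.\<close>

definition new_loops :: "diagram \<Rightarrow> diagram \<Rightarrow> nat" where
  "new_loops D E = card {K \<in> UNIV // stack_conn D E. K \<subseteq> range Middle \<and> infinite K}"

text \<open>The first factor is put on top. The opposite convention gives isomorphic monoids below,
  by reflecting the strip in its horizontal axis.\<close>

definition compose :: "diagram \<Rightarrow> diagram \<Rightarrow> diagram" where
  "compose D E = Diagram {(u, v). (outer u, outer v) \<in> stack_conn D E}
                         (loops D + loops E + new_loops D E)"

definition reduce :: "diagram \<Rightarrow> diagram" where
  "reduce D = Diagram (conn D) 0"


section \<open>Affine, reduced affine, periodic and reduced periodic monoids\<close>

text \<open>The diagram without loops given by the edges \<open>E\<close> and their translates by multiples of \<open>m\<close>.\<close>

definition from_edges :: "nat \<Rightarrow> (vertex \<times> vertex) set \<Rightarrow> diagram" where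
  "from_edges m E =
     (let T = {(shift (t * int m) u, shift (t * int m) v) | t u v. (u, v) \<in> E}
      in Diagram ((T \<union> T\<inverse>)\<^sup>*) 0)"

definition vertical :: "nat \<Rightarrow> int set \<Rightarrow> (vertex \<times> vertex) set" where
  "vertical m I = {(Top j, Bot j) | j. \<forall>i\<in>I. j mod int m \<noteq> i mod int m}"

definition id_diagram :: "nat \<Rightarrow> diagram" where
  "id_diagram m = from_edges m (vertical m {})"

definition gen_e :: "nat \<Rightarrow> int \<Rightarrow> diagram" where
  "gen_e m i = from_edges m
     ({(Top i, Top (i + 1)), (Bot i, Bot (i + 1))} \<union> vertical m {i, i + 1})"

definition gen_l :: "nat \<Rightarrow> int \<Rightarrow> diagram" where
  "gen_l m i = from_edges m ({(Top (i + 1), Bot i)} \<union> vertical m {i, i + 1})"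

definition gen_r :: "nat \<Rightarrow> int \<Rightarrow> diagram" where
  "gen_r m i = from_edges m ({(Top i, Bot (i + 1))} \<union> vertical m {i, i + 1})"

definition gen_s :: "nat \<Rightarrow> int \<Rightarrow> diagram" where
  "gen_s m i = from_edges m
     ({(Top i, Bot (i + 1)), (Top (i + 1), Bot i)} \<union> vertical m {i, i + 1})"

definition gen_p1 :: "nat \<Rightarrow> diagram" where
  "gen_p1 m = from_edges m (vertical m {1})"

datatype family = Temperley_Lieb | Motzkin | Planar_Rook | Rook

datatype variant = Affine | Reduced_Affine | Periodic | Reduced_Periodic

primrec affine_diagrams :: "family \<Rightarrow> nat \<Rightarrow> diagram set" where
  "affine_diagrams Temperley_Lieb m =
     {D. affine_diagram m D \<and> planar D \<and> (\<forall>K\<in>components D. card K = 2)}"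
| "affine_diagrams Motzkin m =
     {D. affine_diagram m D \<and> planar D \<and> (\<forall>K\<in>components D. finite K \<and> card K \<le> 2)}"
| "affine_diagrams Planar_Rook m = {D. affine_diagram m D \<and> planar D \<and> rook_diagram D}"
| "affine_diagrams Rook m = {D. affine_diagram m D \<and> rook_diagram D}"

text \<open>The diagrams \<open>e\<^sub>i\<close>, \<open>l\<^sub>i\<close>, \<open>r\<^sub>i\<close>, \<open>s\<^sub>i\<close> need \<open>i\<close> and \<open>i + 1\<close> to be different modulo \<open>m\<close>; for \<open>m = 1\<close>
  they do not exist, so the index set is empty in that case.\<close>

definition gen_index :: "nat \<Rightarrow> int set" where
  "gen_index m = (if m \<ge> 2 then {0..<int m} else {})"

primrec generators :: "family \<Rightarrow> nat \<Rightarrow> diagram set" where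
  "generators Temperley_Lieb m = gen_e m ` gen_index m"
| "generators Motzkin m = gen_e m ` gen_index m \<union> gen_l m ` gen_index m \<union> gen_r m ` gen_index m"
| "generators Planar_Rook m = gen_l m ` gen_index m \<union> gen_r m ` gen_index m"
| "generators Rook m = insert (gen_p1 m) (gen_s m ` gen_index m)"

definition affine_monoid :: "family \<Rightarrow> nat \<Rightarrow> diagram monoid" where
  "affine_monoid fam m =
     \<lparr>carrier = affine_diagrams fam m, monoid.mult = compose, monoid.one = id_diagram m\<rparr>"

definition reduced_affine_monoid :: "family \<Rightarrow> nat \<Rightarrow> diagram monoid" where
  "reduced_affine_monoid fam m =
     \<lparr>carrier = {D \<in> affine_diagrams fam m. loops D = 0},
      monoid.mult = (\<lambda>D E. reduce (compose D E)), monoid.one = id_diagram m\<rparr>"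

inductive_set generated_submonoid :: "('a, 'b) monoid_scheme \<Rightarrow> 'a set \<Rightarrow> 'a set"
  for M and S where
  gen_one: "\<one>\<^bsub>M\<^esub> \<in> generated_submonoid M S"
| gen_incl: "x \<in> S \<Longrightarrow> x \<in> generated_submonoid M S"
| gen_mult: "x \<in> generated_submonoid M S \<Longrightarrow> y \<in> generated_submonoid M S
          \<Longrightarrow> x \<otimes>\<^bsub>M\<^esub> y \<in> generated_submonoid M S"

primrec diagram_monoid :: "variant \<Rightarrow> family \<Rightarrow> nat \<Rightarrow> diagram monoid" where
  "diagram_monoid Affine fam m = affine_monoid fam m"
| "diagram_monoid Reduced_Affine fam m = reduced_affine_monoid fam m"
| "diagram_monoid Periodic fam m =
     (affine_monoid fam m)
       \<lparr>carrier := generated_submonoid (affine_monoid fam m) (generators fam m)\<rparr>"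
| "diagram_monoid Reduced_Periodic fam m =
     (reduced_affine_monoid fam m)
       \<lparr>carrier := generated_submonoid (reduced_affine_monoid fam m) (generators fam m)\<rparr>"


section \<open>Modules over a monoid and composition series\<close>

text \<open>A \<open>kM\<close>-module: a vector space with a linear action of the monoid \<open>M\<close>.\<close>

definition monoid_module ::
  "'a monoid \<Rightarrow> ('k::field \<Rightarrow> 'v::ab_group_add \<Rightarrow> 'v) \<Rightarrow> ('a \<Rightarrow> 'v \<Rightarrow> 'v) \<Rightarrow> bool" where
  "monoid_module M scale act \<longleftrightarrow>
     vector_space scale \<and>
     (\<forall>x\<in>carrier M. Vector_Spaces.linear scale scale (act x)) \<and>
     act \<one>\<^bsub>M\<^esub> = id \<and>
     (\<forall>x\<in>carrier M. \<forall>y\<in>carrier M. act (x \<otimes>\<^bsub>M\<^esub> y) = act x \<circ> act y)"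

definition is_submodule ::
  "'a monoid \<Rightarrow> ('k::field \<Rightarrow> 'v::ab_group_add \<Rightarrow> 'v) \<Rightarrow> ('a \<Rightarrow> 'v \<Rightarrow> 'v) \<Rightarrow> 'v set \<Rightarrow> bool" where
  "is_submodule M scale act W \<longleftrightarrow>
     module.subspace scale W \<and> (\<forall>x\<in>carrier M. act x ` W \<subseteq> W)"

text \<open>A composition series of the quotient module \<open>H / L\<close>, whose submodules are given by the
  submodules between \<open>L\<close> and \<open>H\<close>: a chain from \<open>L\<close> to \<open>H\<close> with simple successive quotients.\<close>

definition composition_series ::
  "'a monoid \<Rightarrow> ('k::field \<Rightarrow> 'v::ab_group_add \<Rightarrow> 'v) \<Rightarrow> ('a \<Rightarrow> 'v \<Rightarrow> 'v)
     \<Rightarrow> 'v set \<Rightarrow> 'v set \<Rightarrow> 'v set list \<Rightarrow> bool" where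
  "composition_series M scale act L H Ws \<longleftrightarrow>
     Ws \<noteq> [] \<and> hd Ws = L \<and> last Ws = H \<and> (\<forall>W\<in>set Ws. is_submodule M scale act W) \<and>
     (\<forall>i. Suc i < length Ws \<longrightarrow> Ws ! i \<subset> Ws ! Suc i \<and>
        \<not> (\<exists>W. is_submodule M scale act W \<and> Ws ! i \<subset> W \<and> W \<subset> Ws ! Suc i))"


section \<open>Tensor powers\<close>

text \<open>The tensor power is the quotient \<open>tensor_free n / tensor_rel scale n\<close> of the free vector space
  on \<open>n\<close>-tuples of vectors by the relations of multilinearity.\<close>

definition free_scale :: "'k::field \<Rightarrow> ('b \<Rightarrow>\<^sub>0 'k) \<Rightarrow> ('b \<Rightarrow>\<^sub>0 'k)" where
  "free_scale c = Poly_Mapping.map ((*) c)"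

definition tensor_free :: "nat \<Rightarrow> ('v list \<Rightarrow>\<^sub>0 'k::field) set" where
  "tensor_free n = {p. \<forall>vs\<in>Poly_Mapping.keys p. length vs = n}"

definition tensor_rel ::
  "('k::field \<Rightarrow> 'v::ab_group_add \<Rightarrow> 'v) \<Rightarrow> nat \<Rightarrow> ('v list \<Rightarrow>\<^sub>0 'k) set" where
  "tensor_rel scale n = module.span free_scale
     ({Poly_Mapping.single (us @ (v + w) # vs) 1
         - Poly_Mapping.single (us @ v # vs) 1 - Poly_Mapping.single (us @ w # vs) 1
        | us v w vs. length us + 1 + length vs = n} \<union>
      {Poly_Mapping.single (us @ scale c v # vs) 1
         - free_scale c (Poly_Mapping.single (us @ v # vs) 1)
        | us c v vs. length us + 1 + length vs = n})"

text \<open>The diagonal action, extended linearly to formal combinations of tuples.\<close>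

definition tensor_act ::
  "('a \<Rightarrow> 'v \<Rightarrow> 'v) \<Rightarrow> 'a \<Rightarrow> ('v list \<Rightarrow>\<^sub>0 'k::field) \<Rightarrow> ('v list \<Rightarrow>\<^sub>0 'k)" where
  "tensor_act act x p =
     (\<Sum>vs\<in>Poly_Mapping.keys p.
        Poly_Mapping.single (map (act x) vs) (Poly_Mapping.lookup p vs))"

text \<open>Some composition series of the \<open>n\<close>-th tensor power. By the Jordan--Hoelder theorem the
  numbers defined from it do not depend on the choice.\<close>

definition tensor_series ::
  "'a monoid \<Rightarrow> ('k::field \<Rightarrow> 'v::ab_group_add \<Rightarrow> 'v) \<Rightarrow> ('a \<Rightarrow> 'v \<Rightarrow> 'v)
     \<Rightarrow> nat \<Rightarrow> ('v list \<Rightarrow>\<^sub>0 'k) set list" where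
  "tensor_series M scale act n =
     (SOME Ws. composition_series M free_scale (tensor_act act)
                 (tensor_rel scale n) (tensor_free n) Ws)"

definition tensor_length ::
  "'a monoid \<Rightarrow> ('k::field \<Rightarrow> 'v::ab_group_add \<Rightarrow> 'v) \<Rightarrow> ('a \<Rightarrow> 'v \<Rightarrow> 'v) \<Rightarrow> nat \<Rightarrow> nat" where
  "tensor_length M scale act n = length (tensor_series M scale act n) - 1"

text \<open>The nonunits act as zero on the factor \<open>W' / W\<close> iff they map \<open>W'\<close> into \<open>W\<close>.\<close>

definition nonunit_zero_fraction ::
  "'a monoid \<Rightarrow> ('k::field \<Rightarrow> 'v::ab_group_add \<Rightarrow> 'v) \<Rightarrow> ('a \<Rightarrow> 'v \<Rightarrow> 'v) \<Rightarrow> nat \<Rightarrow> real" where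
  "nonunit_zero_fraction M scale act n =
     (let Ws = tensor_series M scale act n in
      real (card {i. Suc i < length Ws \<and>
                     (\<forall>x\<in>carrier M - Units M. tensor_act act x ` (Ws ! Suc i) \<subseteq> Ws ! i)})
      / real (tensor_length M scale act n))"

end

theory Submission
  imports Defs
begin

text \<open>
  Let \<open>d = dim V\<close>. The operators by which \<open>M\<close> acts on the tensor power of degree \<open>n\<close> are of the form
  \<open>g \<otimes> \<dots> \<otimes> g\<close>, and a nonunit acts on \<open>V\<close> with image a proper subspace. So all
  nonunits send the tensor power into the subspace \<open>J\<close> spanned by the pure tensors whose entries do
  not span \<open>V\<close> (\<open>degenerate_tensors\<close>). This \<open>J\<close> is stable under every linear endomorphism
  of \<open>V\<close>, hence a submodule, and it is small: a hyperplane has a basis of the form \<open>b + c\<^sub>b p\<close>,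
  where \<open>p\<close> is one of the basis vectors and \<open>b\<close> runs over the others; expanding a pure tensor in
  these vectors and collecting equal monomials in the scalars \<open>c\<^sub>b\<close> leaves at most
  \<open>q(n) = d (d - 1)^n (n + 1)^d\<close> vectors that span \<open>J\<close> for all hyperplanes at once
  (\<open>degenerate_tensors_bound\<close>), which is \<open>o(d^n)\<close>.

  In a composition series of the tensor power, call a factor good if the nonunits act on it as zero.
  A factor that is not good is covered by \<open>J\<close>, so there are at most \<open>q(n)\<close> of these, and
  together with \<open>J\<close> the good factors account for the dimension \<open>d^n\<close>. On a good factor only the
  units act. The units of all the diagram monoids are bijections \<open>f\<close> of the integers that commute
  with translation by \<open>m\<close>. Those with \<open>f(i)\<close> congruent to \<open>i\<close> modulo \<open>m\<close> commute with one
  another, and finitely many translates of them make up all the units. Over an algebraically closed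
  field, commuting operators have a common eigenvector, and its images under finitely many units span
  the factor; so the dimension of a good factor is at most a constant \<open>b\<close>. Hence
  \<open>d^n \<le> q(n) + b * good(n)\<close> and \<open>good(n) \<le> l(n) \<le> good(n) + q(n)\<close>
  (\<open>tensor_series_counts\<close>), and both claims follow by dividing by \<open>d^n\<close>.
\<close>


section \<open>Chains of subspaces\<close>

context vector_space
begin

text \<open>The Steinitz exchange relative to \<open>W\<close>: a vector outside \<open>W\<close> must really use some \<open>s\<close> in
  \<open>S\<close>, so it can take the place of \<open>s\<close>.\<close>

lemma span_exchange:
  assumes W: "subspace W" and v: "v \<notin> W" "v \<in> span (W \<union> S)" and fin: "finite S"
  obtains s where "s \<in> S" "span (W \<union> S) \<subseteq> span (insert v W \<union> (S - {s}))"
proof -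
  have "\<exists>T. (T \<subseteq> S \<and> v \<in> span (W \<union> T)) \<and> (\<forall>T'. T' \<subseteq> S \<and> v \<in> span (W \<union> T') \<longrightarrow> card T \<le> card T')"
    using ex_has_least_nat[of "\<lambda>T. T \<subseteq> S \<and> v \<in> span (W \<union> T)" S card] v by blast
  then obtain T where T: "T \<subseteq> S" "v \<in> span (W \<union> T)"
    and least: "\<And>T'. T' \<subseteq> S \<Longrightarrow> v \<in> span (W \<union> T') \<Longrightarrow> card T \<le> card T'"
    by blast
  have finT: "finite T" using T fin finite_subset by blast
  have "T \<noteq> {}" using T v W by (metis span_eq_iff sup_bot.right_neutral)
  then obtain s where s: "s \<in> T" by blast
  have "card (T - {s}) < card T" by (rule card_Diff1_less[OF finT s])
  then have "v \<notin> span (W \<union> (T - {s}))" using least[of "T - {s}"] T by auto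
  moreover have "v \<in> span (insert s (W \<union> (T - {s})))"
    by (rule subsetD[OF span_mono T(2)]) auto
  ultimately have "s \<in> span (insert v (W \<union> (T - {s})))" using in_span_insert by blast
  then have "s \<in> span (insert v W \<union> (S - {s}))"
    using span_mono[of "insert v (W \<union> (T - {s}))" "insert v W \<union> (S - {s})"] T by auto
  then have "W \<union> S \<subseteq> span (insert v W \<union> (S - {s}))" by (auto intro: span_base)
  then have "span (W \<union> S) \<subseteq> span (insert v W \<union> (S - {s}))" by (rule span_minimal) simp
  then show ?thesis using that s T by blast
qed

text \<open>Each strict step costs one generator, by exchange. This replaces dimension counting in the
  quotient by \<open>W 0\<close>, which is usually of finite dimension while \<open>W 0\<close> itself is not.\<close>

lemma strict_steps_le_card:
  assumes "\<And>i. i \<le> l \<Longrightarrow> subspace (W i)" "\<And>i. i < l \<Longrightarrow> W i \<subseteq> W (Suc i)"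
    and "W l \<subseteq> span (W 0 \<union> S)" "finite S"
  shows "card {i. i < l \<and> W i \<noteq> W (Suc i)} \<le> card S"
  using assms
proof (induction l arbitrary: W S)
  case 0
  then show ?case by simp
next
  case (Suc l)
  note assms2 = Suc.prems(2)
  have split: "{i. i < Suc l \<and> W i \<noteq> W (Suc i)} =
      (if W 0 = W 1 then {} else {0}) \<union> Suc ` {i. i < l \<and> W (Suc i) \<noteq> W (Suc (Suc i))}"
  proof (rule Set.set_eqI)
    fix i
    show "i \<in> {i. i < Suc l \<and> W i \<noteq> W (Suc i)} \<longleftrightarrow> i \<in>
      (if W 0 = W 1 then {} else {0}) \<union> Suc ` {i. i < l \<and> W (Suc i) \<noteq> W (Suc (Suc i))}"
      by (cases i) auto
  qed
  have step: "card {i. i < l \<and> W (Suc i) \<noteq> W (Suc (Suc i))} \<le> card S'"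
    if "W (Suc l) \<subseteq> span (W 1 \<union> S')" "finite S'" for S'
    using Suc.IH[of "\<lambda>i. W (Suc i)" S'] Suc.prems that by simp
  show ?case
  proof (cases "W 0 = W 1")
    case True
    have "card {i. i < Suc l \<and> W i \<noteq> W (Suc i)} = card {i. i < l \<and> W (Suc i) \<noteq> W (Suc (Suc i))}"
      using True unfolding split by (simp add: card_image)
    then show ?thesis using step[of S] True Suc.prems(3,4) by simp
  next
    case False
    then obtain v where v: "v \<in> W 1" "v \<notin> W 0" using Suc.prems(2)[of 0] by auto
    have "W (Suc l - j) \<subseteq> W (Suc l)" if "j \<le> Suc l" for j
      using that
    proof (induction j rule: nat.induct)
      case (Suc j)
      have "W (l - j) \<subseteq> W (Suc (l - j))" by (rule assms2) simp
      also have "W (Suc (l - j)) = W (Suc l - j)" using Suc.prems by (simp add: Suc_diff_le)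
      also have "\<dots> \<subseteq> W (Suc l)" by (rule Suc.IH) (use Suc.prems in simp)
      finally show ?case by simp
    qed simp
    from this[of l] have sub1: "W 1 \<subseteq> W (Suc l)" by simp
    have "v \<in> span (W 0 \<union> S)" using v sub1 Suc.prems(3) by blast
    then obtain s where s: "s \<in> S" "span (W 0 \<union> S) \<subseteq> span (insert v (W 0) \<union> (S - {s}))"
      using span_exchange[of "W 0" v S] v Suc.prems by auto
    have "insert v (W 0) \<union> (S - {s}) \<subseteq> W 1 \<union> (S - {s})"
      using v Suc.prems(2)[of 0] by auto
    then have "span (insert v (W 0) \<union> (S - {s})) \<subseteq> span (W 1 \<union> (S - {s}))"
      by (rule span_mono)
    with s(2) Suc.prems(3) have "W (Suc l) \<subseteq> span (W 1 \<union> (S - {s}))"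
      by (meson order_trans)
    then have "card {i. i < l \<and> W (Suc i) \<noteq> W (Suc (Suc i))} \<le> card (S - {s})"
      using Suc.prems(4) by (intro step) auto
    moreover have "Suc (card (S - {s})) = card S" by (rule card_Suc_Diff1[OF Suc.prems(4) s(1)])
    moreover have "card {i. i < Suc l \<and> W i \<noteq> W (Suc i)} =
        Suc (card {i. i < l \<and> W (Suc i) \<noteq> W (Suc (Suc i))})"
      using False unfolding split by (simp add: card_image card_insert_if)
    ultimately show ?thesis by simp
  qed
qed

text \<open>A strictly decreasing sequence read backwards from any of its members is a strictly increasing
  chain, whose length is bounded by the number of generators over \<open>W\<close>.\<close>

lemma minimal_subspace_exists:
  assumes P: "P U" and fin: "finite S"
    and between: "\<And>U. P U \<Longrightarrow> subspace U \<and> W \<subseteq> U \<and> U \<subseteq> span (W \<union> S)"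
  obtains U where "P U" "\<And>U'. P U' \<Longrightarrow> \<not> U' \<subset> U"
proof -
  have "wf {(U', U). P U' \<and> P U \<and> U' \<subset> U}"
    unfolding wf_iff_no_infinite_down_chain
  proof
    assume "\<exists>f. \<forall>i. (f (Suc i), f i) \<in> {(U', U). P U' \<and> P U \<and> U' \<subset> U}"
    then obtain f where *: "\<forall>i. (f (Suc i), f i) \<in> {(U', U). P U' \<and> P U \<and> U' \<subset> U}" ..
    have f: "P (f i)" "f (Suc i) \<subset> f i" for i using *[rule_format, of i] by blast+
    have bf: "subspace (f i)" "W \<subseteq> f i" "f i \<subseteq> span (W \<union> S)" for i
      using between[OF f(1)[of i]] by simp_all
    define n where "n = Suc (card S)"
    have "card {i. i < n \<and> f (n - i) \<noteq> f (n - Suc i)} \<le> card S"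
    proof (rule strict_steps_le_card[where W = "\<lambda>i. f (n - i)"])
      show "f (n - i) \<subseteq> f (n - Suc i)" if "i < n" for i
      proof -
        have "n - i = Suc (n - Suc i)" using that by simp
        then show ?thesis using f(2)[of "n - Suc i"] by (simp add: psubset_imp_subset)
      qed
      have "span (W \<union> S) \<subseteq> span (f (n - 0) \<union> S)"
        by (intro span_mono Un_mono bf order_refl)
      then show "f (n - n) \<subseteq> span (f (n - 0) \<union> S)" using bf(3) by (rule order_trans[rotated])
    qed (rule bf fin)+
    moreover have "{i. i < n \<and> f (n - i) \<noteq> f (n - Suc i)} = {..<n}"
    proof -
      have "f (n - i) \<noteq> f (n - Suc i)" if "i < n" for i
      proof -
        have "n - i = Suc (n - Suc i)" using that by simp
        then show ?thesis using f(2)[of "n - Suc i"] by auto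
      qed
      then show ?thesis by auto
    qed
    ultimately show False by (simp add: n_def)
  qed
  moreover have "U \<in> Collect P" using P by simp
  ultimately obtain U0 where U0: "U0 \<in> Collect P"
    "\<And>y. (y, U0) \<in> {(U', U). P U' \<and> P U \<and> U' \<subset> U} \<Longrightarrow> y \<notin> Collect P"
    by (rule wfE_min) blast
  show ?thesis by (rule that[of U0]) (use U0 in auto)
qed

lemma subspace_plus_span:
  fixes f :: "nat \<Rightarrow> 'b"
  assumes "subspace W" "x \<in> span (W \<union> (f ` {..<i}))"
  shows "\<exists>c. x - (\<Sum>j<i. scale (c j) (f j)) \<in> W"
  using assms(2)
proof (induction i arbitrary: x rule: nat.induct)
  case zero
  moreover have "span W = W" by (simp add: assms(1))
  ultimately show ?case by simp
next
  case (Suc i)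
  have "W \<union> f ` {..<Suc i} = insert (f i) (W \<union> f ` {..<i})" by (auto simp: lessThan_Suc)
  then obtain k where "x - scale k (f i) \<in> span (W \<union> f ` {..<i})"
    using Suc.prems span_breakdown_eq by auto
  then obtain c where "x - scale k (f i) - (\<Sum>j<i. scale (c j) (f j)) \<in> W" using Suc.IH by blast
  then have "x - (\<Sum>j<Suc i. scale ((c(i := k)) j) (f j)) \<in> W"
    by (simp add: algebra_simps)
  then show ?case by blast
qed

end

section \<open>Common eigenvectors modulo a subspace\<close>

text \<open>The usual argument in the quotient \<open>U / W\<close>: take a vector \<open>v\<close> outside \<open>W\<close> and a nonzero
  polynomial \<open>q\<close> of least degree for which \<open>q(a) v\<close> lies in \<open>W\<close>. It has a root \<open>z\<close>; writing
  \<open>q = (X - z) r\<close>, the vector \<open>r(a) v\<close> is outside \<open>W\<close> and is an eigenvector modulo \<open>W\<close>.\<close>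

lemma eigenvector_modulo:
  fixes scale :: "'k::alg_closed_field \<Rightarrow> 'v::ab_group_add \<Rightarrow> 'v"
  assumes "Vector_Spaces.linear scale scale a"
    and W: "module.subspace scale W" "W \<subset> U" "U \<subseteq> module.span scale (W \<union> S)" "finite S"
    and U: "module.subspace scale U" "a ` U \<subseteq> U"
  obtains u c where "u \<in> U" "u \<notin> W" "a u - scale c u \<in> W"
proof -
  interpret vector_space scale using assms(1) by (simp add: Vector_Spaces.linear_def)
  interpret a: Vector_Spaces.linear scale scale a by fact
  obtain v where v: "v \<in> U" "v \<notin> W" using W by blast
  have pow: "(a ^^ i) v \<in> U" for i by (induction i) (use v U in auto)
  define f where "f i = (a ^^ i) v" for i
  define ev where "ev N q = (\<Sum>i\<le>N. scale (coeff q i) (f i))" for N and q :: "'k poly"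
  have ev_add: "ev N (p + q) = ev N p + ev N q" for N p q
    by (simp add: ev_def scale_left_distrib sum.distrib)
  have ev_smult: "ev N (smult c p) = scale c (ev N p)" for N p c
    by (simp add: ev_def scale_sum_right)
  have ev_pCons: "ev (Suc N) (pCons 0 p) = a (ev N p)" for N p
    unfolding ev_def sum.atMost_Suc_shift by (simp add: a.sum a.scale f_def)
  have ev_Suc: "ev (Suc N) p = ev N p" if "degree p \<le> N" for N p
    using that by (simp add: ev_def coeff_eq_0)
  have ev_in: "ev N p \<in> U" for N p
    unfolding ev_def f_def by (intro subspace_sum subspace_scale U pow)
  \<comment> \<open>the powers of \<open>a\<close> on \<open>v\<close> cannot stay independent modulo \<open>W\<close>, so some nonzero polynomial
    in \<open>a\<close> sends \<open>v\<close> into \<open>W\<close>\<close>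
  have "\<exists>i. f i \<in> span (W \<union> f ` {..<i})"
  proof (rule ccontr)
    assume no: "\<not> ?thesis"
    define l where "l = Suc (card S)"
    have "W \<union> f ` {..<l} \<subseteq> U" using W pow by (auto simp: f_def)
    then have "span (W \<union> f ` {..<l}) \<subseteq> U" using U span_minimal by blast
    then have "span (W \<union> f ` {..<l}) \<subseteq> span (W \<union> S)" using W(3) by (rule order_trans)
    also have "\<dots> \<subseteq> span (span (W \<union> f ` {..<0}) \<union> S)"
      by (rule span_mono) (auto intro: span_base)
    finally have "card {i. i < l \<and> span (W \<union> f ` {..<i}) \<noteq> span (W \<union> f ` {..<Suc i})} \<le> card S"
      using W(4) by (intro strict_steps_le_card) (auto intro!: span_mono)
    moreover have "f i \<in> span (W \<union> f ` {..<Suc i})" for i by (rule span_base) auto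
    then have "{i. i < l \<and> span (W \<union> f ` {..<i}) \<noteq> span (W \<union> f ` {..<Suc i})} = {..<l}"
      using no by blast
    ultimately show False by (simp add: l_def)
  qed
  then obtain i c where c: "f i - (\<Sum>j<i. scale (c j) (f j)) \<in> W"
    using subspace_plus_span[OF W(1)] by blast
  define q0 where "q0 = monom 1 i - (\<Sum>j<i. monom (c j) j)"
  have q0_coeff: "coeff q0 j = (if j = i then 1 else if j < i then - c j else 0)" for j
    by (simp add: q0_def coeff_sum coeff_monom sum.delta eq_commute[of j])
  have "ev i q0 = f i - (\<Sum>j<i. scale (c j) (f j))"
    by (simp add: ev_def q0_coeff lessThan_Suc_atMost[symmetric] sum_negf)
  moreover have "degree q0 \<le> i" by (rule degree_le) (simp add: q0_coeff)
  moreover have "ev N p = ev M p" if "degree p \<le> N" "N \<le> M" for N M p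
    using that(2) by (induction rule: dec_induct) (use that ev_Suc in auto)
  ultimately have "ev (degree q0) q0 \<in> W" using c by (metis order_refl)
  moreover have "q0 \<noteq> 0" using q0_coeff[of i] by auto
  ultimately obtain q where q: "q \<noteq> 0" "ev (degree q) q \<in> W"
    and least: "\<And>p. p \<noteq> 0 \<Longrightarrow> ev (degree p) p \<in> W \<Longrightarrow> degree q \<le> degree p"
    using ex_has_least_nat[of "\<lambda>q. q \<noteq> 0 \<and> ev (degree q) q \<in> W" q0 degree] by blast
  have "degree q > 0"
  proof (rule ccontr)
    assume "\<not> ?thesis"
    then obtain k where k: "q = [:k:]" using degree_eq_zeroE by auto
    then have "scale k v \<in> W" "k \<noteq> 0" using q by (auto simp: ev_def f_def)
    then have "scale (inverse k) (scale k v) \<in> W" using subspace_scale[OF W(1)] by blast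
    then show False using v \<open>k \<noteq> 0\<close> by simp
  qed
  then obtain z where "poly q z = 0" using alg_closed_imp_poly_has_root by blast
  then obtain r where r: "q = [:-z, 1:] * r" using poly_eq_0_iff_dvd by (meson dvdE)
  then have r0: "r \<noteq> 0" using q by auto
  have deg: "degree q = Suc (degree r)" unfolding r using r0 by (subst degree_mult_eq) auto
  have "q = pCons 0 r + smult (- z) r" by (simp add: r)
  then have "ev (degree q) q = ev (Suc (degree r)) (pCons 0 r + smult (- z) r)"
    unfolding deg by (rule arg_cong)
  also have "\<dots> = a (ev (degree r) r) - scale z (ev (degree r) r)"
    by (simp only: ev_add ev_smult ev_pCons ev_Suc[OF order_refl]) simp
  finally have "ev (degree q) q = a (ev (degree r) r) - scale z (ev (degree r) r)" .
  then have "a (ev (degree r) r) - scale z (ev (degree r) r) \<in> W" using q by simp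
  moreover have "ev (degree r) r \<notin> W" using least[OF r0] deg by auto
  ultimately show ?thesis using that ev_in by blast
qed

text \<open>In a minimal stable subspace strictly above \<open>W\<close>, each operator acts modulo \<open>W\<close> as a scalar,
  because its eigenspaces are stable as well.\<close>

lemma common_eigenvector_modulo:
  fixes scale :: "'k::alg_closed_field \<Rightarrow> 'v::ab_group_add \<Rightarrow> 'v"
  assumes lin: "\<And>a. a \<in> A \<Longrightarrow> Vector_Spaces.linear scale scale a"
    and comm: "\<And>a b. a \<in> A \<Longrightarrow> b \<in> A \<Longrightarrow> a \<circ> b = b \<circ> a"
    and vs: "vector_space scale"
    and W: "module.subspace scale W" "W \<subset> U" "U \<subseteq> module.span scale (W \<union> S)" "finite S"
      "\<And>a. a \<in> A \<Longrightarrow> a ` W \<subseteq> W"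
    and U: "module.subspace scale U" "\<And>a. a \<in> A \<Longrightarrow> a ` U \<subseteq> U"
  obtains u where "u \<in> U" "u \<notin> W" "\<And>a. a \<in> A \<Longrightarrow> \<exists>c. a u - scale c u \<in> W"
proof -
  interpret vector_space scale by fact
  define P where "P X \<longleftrightarrow> subspace X \<and> W \<subset> X \<and> X \<subseteq> U \<and> (\<forall>a\<in>A. a ` X \<subseteq> X)" for X
  have "P U" using U W by (auto simp: P_def)
  moreover have "subspace X \<and> W \<subseteq> X \<and> X \<subseteq> span (W \<union> S)" if "P X" for X
    using that W by (auto simp: P_def)
  ultimately obtain X where X: "P X" and min: "\<And>X'. P X' \<Longrightarrow> \<not> X' \<subset> X"
    using minimal_subspace_exists[of P U S W] W by metis
  obtain u where u: "u \<in> X" "u \<notin> W" using X by (auto simp: P_def)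
  have "\<exists>c. a u - scale c u \<in> W" if a: "a \<in> A" for a
  proof -
    interpret a: Vector_Spaces.linear scale scale a by (rule lin[OF a])
    have "X \<subseteq> span (W \<union> S)" using X W by (auto simp: P_def)
    moreover have "W \<subset> X" "subspace X" "a ` X \<subseteq> X" using X a by (auto simp: P_def)
    ultimately obtain x c where x: "x \<in> X" "x \<notin> W" "a x - scale c x \<in> W"
      using eigenvector_modulo[OF lin[OF a] W(1) _ _ W(4)] by metis
    \<comment> \<open>the eigenspace is stable because the operators commute, so it is everything\<close>
    define X' where "X' = {y \<in> X. a y - scale c y \<in> W}"
    have "subspace X'"
    proof (rule subspaceI)
      have "subspace X" using X by (simp add: P_def)
      note sub = subspace_0[OF this] subspace_add[OF this] subspace_scale[OF this]
      show "0 \<in> X'" using sub W by (simp add: X'_def subspace_0)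
      fix y z k assume yz: "y \<in> X'"
      have "a (scale k y) - scale c (scale k y) = scale k (a y - scale c y)"
        by (simp add: a.scale scale_right_diff_distrib mult.commute)
      then show "scale k y \<in> X'" using yz sub W subspace_scale by (auto simp: X'_def)
      assume z: "z \<in> X'"
      have "a (y + z) - scale c (y + z) = (a y - scale c y) + (a z - scale c z)"
        by (simp add: a.add scale_right_distrib)
      then show "y + z \<in> X'" using yz z sub W subspace_add by (auto simp: X'_def)
    qed
    moreover have "b ` X' \<subseteq> X'" if b: "b \<in> A" for b
    proof
      interpret b: Vector_Spaces.linear scale scale b by (rule lin[OF b])
      fix z assume "z \<in> b ` X'"
      then obtain y where y: "y \<in> X" "a y - scale c y \<in> W" "z = b y" by (auto simp: X'_def)
      have "a (b y) = b (a y)" using comm[OF a b] by (metis comp_apply)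
      then have "a (b y) - scale c (b y) = b (a y - scale c y)" by (simp add: b.diff b.scale)
      moreover have "b (a y - scale c y) \<in> W" using W(5)[OF b] y by blast
      moreover have "b ` X \<subseteq> X" using X b unfolding P_def by blast
      then have "b y \<in> X" using y by blast
      ultimately show "z \<in> X'" using y by (simp add: X'_def)
    qed
    moreover have "W \<subset> X'"
    proof
      show "W \<subseteq> X'"
      proof
        fix w assume w: "w \<in> W"
        then have "a w - scale c w \<in> W" using W(5)[OF a] W(1)
          by (auto intro!: subspace_diff subspace_scale)
        then show "w \<in> X'" using w X by (auto simp: X'_def P_def)
      qed
      show "W \<noteq> X'" using x by (auto simp: X'_def)
    qed
    ultimately have "P X'" using X by (auto simp: P_def X'_def)
    then have "X' = X" using min by (auto simp: X'_def)
    then show ?thesis using u by (auto simp: X'_def)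
  qed
  then show ?thesis using that u X by (auto simp: P_def)
qed

section \<open>Composition series\<close>

lemma is_submoduleD:
  assumes "is_submodule M scale act W"
  shows "module.subspace scale W" "x \<in> carrier M \<Longrightarrow> w \<in> W \<Longrightarrow> act x w \<in> W"
  using assms by (auto simp: is_submodule_def)

text \<open>Put a minimal submodule above \<open>L\<close> next in the series; by exchange one generator fewer is needed
  from there on.\<close>

lemma composition_series_exists:
  assumes "vector_space scale" and fin: "finite S"
    and "is_submodule M scale act L" and H: "is_submodule M scale act H"
    and "L \<subseteq> H" "H \<subseteq> module.span scale (L \<union> S)"
  shows "\<exists>Ws. composition_series M scale act L H Ws"
proof -
  interpret vector_space scale by fact
  have "\<exists>Ws. composition_series M scale act L H Ws"
    if "finite S" "is_submodule M scale act L" "L \<subseteq> H" "H \<subseteq> span (L \<union> S)" for L S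
    using that
  proof (induction "card S" arbitrary: L S rule: less_induct)
    case less
    show ?case
    proof (cases "L = H")
      case True
      then have "composition_series M scale act L H [L]"
        using less.prems by (simp add: composition_series_def)
      then show ?thesis by blast
    next
      case False
      define P where "P U \<longleftrightarrow> is_submodule M scale act U \<and> L \<subset> U \<and> U \<subseteq> H" for U
      have "P H" using False less.prems H by (auto simp: P_def)
      moreover have "subspace U \<and> L \<subseteq> U \<and> U \<subseteq> span (L \<union> S)" if "P U" for U
        using that less.prems by (auto simp: P_def is_submodule_def)
      ultimately obtain U where U: "P U" and min: "\<And>U'. P U' \<Longrightarrow> \<not> U' \<subset> U"
        using minimal_subspace_exists[of P H S L] less.prems by metis
      obtain v where v: "v \<in> U" "v \<notin> L" using U by (auto simp: P_def)
      have "v \<in> span (L \<union> S)" using v U less.prems by (auto simp: P_def)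
      moreover have "subspace L" using less.prems by (simp add: is_submodule_def)
      ultimately obtain s where s: "s \<in> S" "span (L \<union> S) \<subseteq> span (insert v L \<union> (S - {s}))"
        using span_exchange v less.prems by metis
      have "span (insert v L \<union> (S - {s})) \<subseteq> span (U \<union> (S - {s}))"
        by (rule span_mono) (use v U in \<open>auto simp: P_def\<close>)
      then have "H \<subseteq> span (U \<union> (S - {s}))" using s less.prems by blast
      moreover have "card (S - {s}) < card S"
        by (rule card_Diff1_less) (use s less.prems in auto)
      ultimately obtain Ws where Ws: "composition_series M scale act U H Ws"
        using less.hyps[of "S - {s}" U] less.prems U by (auto simp: P_def)
      have "composition_series M scale act L H (L # Ws)"
        unfolding composition_series_def
      proof (intro conjI allI impI)
        fix i assume i: "Suc i < length (L # Ws)"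
        have "(L # Ws) ! i \<subset> (L # Ws) ! Suc i \<and>
          \<not> (\<exists>W. is_submodule M scale act W \<and> (L # Ws) ! i \<subset> W \<and> W \<subset> (L # Ws) ! Suc i)"
        proof (cases i)
          case 0
          have "Ws ! 0 = U" using Ws by (auto simp: composition_series_def hd_conv_nth)
          moreover have "\<not> (\<exists>W. is_submodule M scale act W \<and> L \<subset> W \<and> W \<subset> U)"
            using U min unfolding P_def by blast
          ultimately show ?thesis using 0 U by (simp add: P_def)
        next
          case (Suc j)
          then show ?thesis using Ws i by (auto simp: composition_series_def)
        qed
        then show "(L # Ws) ! i \<subset> (L # Ws) ! Suc i"
          "\<not> (\<exists>W. is_submodule M scale act W \<and> (L # Ws) ! i \<subset> W \<and> W \<subset> (L # Ws) ! Suc i)"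
          by blast+
      qed (use Ws less.prems in \<open>auto simp: composition_series_def\<close>)
      then show ?thesis by blast
    qed
  qed
  then show ?thesis using assms by blast
qed

lemma composition_series_nth:
  assumes "composition_series M scale act L H Ws"
  shows "Ws ! 0 = L" "Ws ! (length Ws - 1) = H" "length Ws > 0"
    "i < length Ws \<Longrightarrow> is_submodule M scale act (Ws ! i)"
    "Suc i < length Ws \<Longrightarrow> Ws ! i \<subset> Ws ! Suc i"
  using assms by (auto simp: composition_series_def hd_conv_nth last_conv_nth)

lemma composition_series_mono:
  assumes "composition_series M scale act L H Ws" "j < length Ws" "i \<le> j"
  shows "Ws ! i \<subseteq> Ws ! j"
  using assms(3,2)
proof (induction rule: dec_induct)
  case (step n)
  then show ?case using composition_series_nth(5)[OF assms(1), of n] by auto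
qed auto

lemma composition_series_between:
  assumes "composition_series M scale act L H Ws" "i < length Ws"
  shows "L \<subseteq> Ws ! i" "Ws ! i \<subseteq> H"
  using composition_series_mono[OF assms(1), of i 0] composition_series_mono[OF assms(1), of "length Ws - 1" i]
    composition_series_nth[OF assms(1)] assms(2) by auto

text \<open>The subspaces \<open>J \<inter> Ws ! i\<close> form a chain from \<open>L\<close> to \<open>J\<close>, and the steps counted here are
  among its strict ones.\<close>

lemma card_strict_steps_Int:
  assumes "vector_space scale" and Ws: "composition_series M scale act L H Ws"
    and J: "module.subspace scale J" "L \<subseteq> J" "J \<subseteq> module.span scale (L \<union> S)" "finite S"
  shows "card {i. Suc i < length Ws \<and> \<not> J \<inter> Ws ! Suc i \<subseteq> Ws ! i} \<le> card S"
proof -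
  interpret vector_space scale by fact
  note nth = composition_series_nth[OF Ws]
  have "card {i. i < length Ws - 1 \<and> J \<inter> Ws ! i \<noteq> J \<inter> Ws ! Suc i} \<le> card S"
  proof (rule strict_steps_le_card)
    show "subspace (J \<inter> Ws ! i)" if "i \<le> length Ws - 1" for i
    proof -
      have "i < length Ws" using that nth(3) by linarith
      then show ?thesis using J(1) is_submoduleD(1)[OF nth(4)] by (intro subspace_inter)
    qed
    show "J \<inter> Ws ! i \<subseteq> J \<inter> Ws ! Suc i" if "i < length Ws - 1" for i
    proof -
      have "Suc i < length Ws" using that by linarith
      then show ?thesis using nth(5) by blast
    qed
    show "J \<inter> Ws ! (length Ws - 1) \<subseteq> span (J \<inter> Ws ! 0 \<union> S)"
      using J nth(1) by (auto simp: Int_absorb1)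
  qed fact
  moreover have "{i. Suc i < length Ws \<and> \<not> J \<inter> Ws ! Suc i \<subseteq> Ws ! i} \<subseteq>
      {i. i < length Ws - 1 \<and> J \<inter> Ws ! i \<noteq> J \<inter> Ws ! Suc i}"
    by auto
  moreover have "finite {i. i < length Ws - 1 \<and> J \<inter> Ws ! i \<noteq> J \<inter> Ws ! Suc i}" by simp
  ultimately show ?thesis by (meson card_mono le_trans)
qed

lemma composition_series_length_le:
  assumes "vector_space scale" and Ws: "composition_series M scale act L H Ws"
    and "H \<subseteq> module.span scale (L \<union> S)" "finite S"
  shows "length Ws - 1 \<le> card S"
proof -
  note nth = composition_series_nth[OF Ws]
  have "\<not> H \<inter> Ws ! Suc i \<subseteq> Ws ! i" if "Suc i < length Ws" for i
    using nth(5)[OF that] composition_series_between(2)[OF Ws that] by (auto simp: Int_absorb1)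
  then have "{i. Suc i < length Ws \<and> \<not> H \<inter> Ws ! Suc i \<subseteq> Ws ! i} = {..<length Ws - 1}"
    by auto
  moreover have "module.subspace scale H"
    using nth(2,3) nth(4)[of "length Ws - 1"] by (simp add: is_submodule_def)
  moreover have "L \<subseteq> H" using composition_series_between(2)[OF Ws, of 0] nth by auto
  ultimately show ?thesis using card_strict_steps_Int[OF assms(1) Ws _ _ assms(3,4)] by simp
qed

lemma (in vector_space) chain_subset_span:
  assumes "\<And>i. i < l \<Longrightarrow> W (Suc i) \<subseteq> span (W i \<union> X i)"
  shows "W l \<subseteq> span (W 0 \<union> (\<Union>i<l. X i))"
  using assms
proof (induction l)
  case 0
  then show ?case by (auto intro: span_base)
next
  case (Suc l)
  let ?Y = "span (W 0 \<union> (\<Union>i<Suc l. X i))"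
  have "span (W 0 \<union> (\<Union>i<l. X i)) \<subseteq> ?Y" by (rule span_mono) auto
  then have "W l \<subseteq> ?Y" using Suc by auto
  moreover have "X l \<subseteq> ?Y" by (auto intro: span_base)
  ultimately have "span (W l \<union> X l) \<subseteq> ?Y" by (intro span_minimal) auto
  then show ?case using Suc.prems[of l] by auto
qed

lemma is_submodule_span_Un:
  assumes vs: "vector_space scale"
    and lin: "\<And>x. x \<in> carrier M \<Longrightarrow> Vector_Spaces.linear scale scale (act x)"
    and W: "is_submodule M scale act W"
    and X: "\<And>x. x \<in> carrier M \<Longrightarrow> act x ` X \<subseteq> module.span scale (W \<union> X)"
  shows "is_submodule M scale act (module.span scale (W \<union> X))"
proof -
  interpret vector_space scale by fact
  have "act x ` span (W \<union> X) \<subseteq> span (W \<union> X)" if x: "x \<in> carrier M" for x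
  proof -
    interpret a: Vector_Spaces.linear scale scale "act x" by (rule lin[OF x])
    have "act x ` (W \<union> X) \<subseteq> span (W \<union> X)"
      using X[OF x] is_submoduleD(2)[OF W x] by (auto intro: span_base)
    then have "span (act x ` (W \<union> X)) \<subseteq> span (W \<union> X)" by (rule span_minimal) simp
    then show ?thesis by (simp only: a.span_image)
  qed
  then show ?thesis by (simp add: is_submodule_def)
qed

text \<open>By simplicity of the factor, the nonzero submodule that \<open>J\<close> induces in it is everything.\<close>

lemma composition_factor_covered:
  assumes vs: "vector_space scale" and Ws: "composition_series M scale act L H Ws"
    and lin: "\<And>x. x \<in> carrier M \<Longrightarrow> Vector_Spaces.linear scale scale (act x)"
    and J: "is_submodule M scale act J"
    and i: "Suc i < length Ws" "\<not> J \<inter> Ws ! Suc i \<subseteq> Ws ! i"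
  shows "Ws ! Suc i \<subseteq> module.span scale (Ws ! i \<union> J)"
proof -
  interpret vector_space scale by fact
  note nth = composition_series_nth[OF Ws]
  let ?X = "span (Ws ! i \<union> (J \<inter> Ws ! Suc i))"
  have sub: "is_submodule M scale act (Ws ! i)" "is_submodule M scale act (Ws ! Suc i)"
    using nth(4) i by auto
  have "is_submodule M scale act ?X"
    by (rule is_submodule_span_Un[OF vs lin sub(1)])
      (auto intro!: span_base dest: is_submoduleD(2)[OF J] is_submoduleD(2)[OF sub(2)])
  moreover have "Ws ! i \<subset> ?X" using i(2) by (auto intro: span_base)
  moreover have "?X \<subseteq> Ws ! Suc i"
    using nth(5)[OF i(1)] sub(2) by (intro span_minimal) (auto simp: is_submodule_def)
  ultimately have "?X = Ws ! Suc i"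
    using Ws i(1) unfolding composition_series_def by blast
  moreover have "?X \<subseteq> span (Ws ! i \<union> J)" by (rule span_mono) auto
  ultimately show ?thesis by simp
qed

section \<open>Linear maps on free vector spaces\<close>

lemma lookup_free_scale [simp]: "Poly_Mapping.lookup (free_scale c p) k = c * Poly_Mapping.lookup p k"
  by (simp add: free_scale_def Poly_Mapping.map.rep_eq when_def)

interpretation free: vector_space "free_scale :: 'k::field \<Rightarrow> ('b \<Rightarrow>\<^sub>0 'k) \<Rightarrow> ('b \<Rightarrow>\<^sub>0 'k)"
  by unfold_locales (auto intro!: poly_mapping_eqI simp: lookup_add algebra_simps)

lemma free_scale_single [simp]: "free_scale c (Poly_Mapping.single k x) = Poly_Mapping.single k (c * x)"
  by (rule poly_mapping_eqI) (simp add: lookup_single when_def)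

definition linear_extension :: "('b \<Rightarrow> ('c \<Rightarrow>\<^sub>0 'k::field)) \<Rightarrow> ('b \<Rightarrow>\<^sub>0 'k) \<Rightarrow> ('c \<Rightarrow>\<^sub>0 'k)" where
  "linear_extension f p = (\<Sum>x\<in>Poly_Mapping.keys p. free_scale (Poly_Mapping.lookup p x) (f x))"

lemma linear_extension_eq:
  assumes "finite A" "Poly_Mapping.keys p \<subseteq> A"
  shows "linear_extension f p = (\<Sum>x\<in>A. free_scale (Poly_Mapping.lookup p x) (f x))"
  unfolding linear_extension_def
  by (rule sum.mono_neutral_left) (use assms in \<open>auto simp: in_keys_iff\<close>)

lemma linear_linear_extension:
  fixes f :: "'b \<Rightarrow> ('c \<Rightarrow>\<^sub>0 'k::field)"
  shows "Vector_Spaces.linear free_scale free_scale (linear_extension f)"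
proof (rule Vector_Spaces.linear_iff[THEN iffD2], intro conjI allI)
  fix p q :: "'b \<Rightarrow>\<^sub>0 'k" and c
  let ?A = "Poly_Mapping.keys p \<union> Poly_Mapping.keys q"
  have "linear_extension f (p + q) = (\<Sum>x\<in>?A. free_scale (Poly_Mapping.lookup (p + q) x) (f x))"
    by (rule linear_extension_eq) (use keys_add[of p q] in auto)
  then show "linear_extension f (p + q) = linear_extension f p + linear_extension f q"
    by (simp add: linear_extension_eq[of ?A] lookup_add free.scale_left_distrib sum.distrib)
  have "linear_extension f (free_scale c p) =
      (\<Sum>x\<in>Poly_Mapping.keys p. free_scale (Poly_Mapping.lookup (free_scale c p) x) (f x))"
    by (rule linear_extension_eq) (auto simp: in_keys_iff)
  then show "linear_extension f (free_scale c p) = free_scale c (linear_extension f p)"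
    by (simp add: linear_extension_def free.scale_sum_right)
qed (unfold_locales)

lemma linear_extension_single [simp]:
  "linear_extension f (Poly_Mapping.single x c) = free_scale c (f x)"
  by (subst linear_extension_eq[of "{x}"]) auto

lemma poly_mapping_sum_single:
  "p = (\<Sum>x\<in>Poly_Mapping.keys p. free_scale (Poly_Mapping.lookup p x) (Poly_Mapping.single x 1))"
  by (rule poly_mapping_eqI) (simp add: lookup_sum lookup_single when_def in_keys_iff)

lemma tensor_act_eq_linear_extension:
  "tensor_act act x = linear_extension (\<lambda>vs. Poly_Mapping.single (map (act x) vs) 1)"
  by (simp add: tensor_act_def linear_extension_def fun_eq_iff)

lemma linear_tensor_act: "Vector_Spaces.linear free_scale free_scale (tensor_act act x)"
  unfolding tensor_act_eq_linear_extension by (rule linear_linear_extension)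

lemma tensor_act_single [simp]:
  "tensor_act act x (Poly_Mapping.single vs c) = Poly_Mapping.single (map (act x) vs) c"
  by (simp add: tensor_act_eq_linear_extension)

lemma linear_eq_if_eq_on_singles:
  fixes F G :: "('b \<Rightarrow>\<^sub>0 'k::field) \<Rightarrow> ('c \<Rightarrow>\<^sub>0 'k)"
  assumes "Vector_Spaces.linear free_scale free_scale F" "Vector_Spaces.linear free_scale free_scale G"
    and "\<And>x. F (Poly_Mapping.single x 1) = G (Poly_Mapping.single x 1)"
  shows "F = G"
proof
  fix p :: "'b \<Rightarrow>\<^sub>0 'k"
  interpret F: Vector_Spaces.linear free_scale free_scale F by fact
  interpret G: Vector_Spaces.linear free_scale free_scale G by fact
  let ?q = "\<Sum>x\<in>Poly_Mapping.keys p. free_scale (Poly_Mapping.lookup p x) (Poly_Mapping.single x 1)"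
  have "F ?q = G ?q" by (simp only: F.sum F.scale G.sum G.scale assms(3))
  then show "F p = G p" by (simp only: poly_mapping_sum_single[symmetric])
qed

lemma tensor_act_comp:
  assumes "act z = act x \<circ> act y"
  shows "tensor_act act z = tensor_act act x \<circ> tensor_act act y"
  by (rule linear_eq_if_eq_on_singles)
    (auto intro!: linear_tensor_act Vector_Spaces.linear_compose simp: assms)

lemma tensor_free_eq_span:
  "tensor_free n = free.span {Poly_Mapping.single vs (1::'k::field) | vs. length vs = n}"
    (is "_ = free.span ?X")
proof
  show "tensor_free n \<subseteq> free.span ?X"
  proof
    fix p :: "'a list \<Rightarrow>\<^sub>0 'k" assume "p \<in> tensor_free n"
    then have "(\<Sum>x\<in>Poly_Mapping.keys p. free_scale (Poly_Mapping.lookup p x) (Poly_Mapping.single x 1)) \<in> free.span ?X"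
      by (intro free.span_sum free.span_scale free.span_base) (auto simp: tensor_free_def)
    then show "p \<in> free.span ?X" by (simp only: poly_mapping_sum_single[symmetric])
  qed
  have "free.subspace (tensor_free n :: ('a list \<Rightarrow>\<^sub>0 'k) set)"
    by (rule free.subspaceI) (use keys_add in \<open>fastforce simp: tensor_free_def in_keys_iff lookup_add\<close>)+
  then show "free.span ?X \<subseteq> tensor_free n"
    by (intro free.span_minimal) (auto simp: tensor_free_def)
qed

lemma subspace_tensor_free: "free.subspace (tensor_free n)"
  by (simp add: tensor_free_eq_span)

section \<open>A basis of the tensor power\<close>

context vector_space
begin

lemma subspace_tensor_rel: "free.subspace (tensor_rel scale n)"
  by (simp add: tensor_rel_def)

lemma tensor_rel_add:
  assumes "length us + 1 + length vs = n"
  shows "Poly_Mapping.single (us @ (v + w) # vs) 1 - Poly_Mapping.single (us @ v # vs) 1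
    - Poly_Mapping.single (us @ w # vs) 1 \<in> tensor_rel scale n"
  unfolding tensor_rel_def using assms by (intro free.span_base UnI1) blast

lemma tensor_rel_scale:
  assumes "length us + 1 + length vs = n"
  shows "Poly_Mapping.single (us @ scale c v # vs) 1
    - free_scale c (Poly_Mapping.single (us @ v # vs) 1) \<in> tensor_rel scale n"
  unfolding tensor_rel_def using assms by (intro free.span_base UnI2) blast

lemma tensor_rel_subset_tensor_free: "tensor_rel scale n \<subseteq> tensor_free n"
  unfolding tensor_rel_def
proof (rule free.span_minimal[OF _ subspace_tensor_free], rule subsetI)
  have single: "Poly_Mapping.single xs c \<in> tensor_free k" if "length xs = k"
    for xs :: "'b list" and c :: 'a and k
    using that by (auto simp: tensor_free_def)
  note sub = free.subspace_diff[OF subspace_tensor_free]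
  fix p :: "'b list \<Rightarrow>\<^sub>0 'a"
  assume "p \<in> {Poly_Mapping.single (us @ (v + w) # vs) 1
         - Poly_Mapping.single (us @ v # vs) 1 - Poly_Mapping.single (us @ w # vs) 1
        | us v w vs. length us + 1 + length vs = n} \<union>
      {Poly_Mapping.single (us @ scale c v # vs) 1
         - free_scale c (Poly_Mapping.single (us @ v # vs) 1)
        | us c v vs. length us + 1 + length vs = n}"
  then show "p \<in> tensor_free n"
    by (auto intro!: sub single)
qed

lemma tensor_act_tensor_rel:
  assumes "Vector_Spaces.linear scale scale (act x)"
  shows "tensor_act act x ` tensor_rel scale n \<subseteq> tensor_rel scale n"
proof -
  interpret a: Vector_Spaces.linear scale scale "act x" by fact
  interpret t: Vector_Spaces.linear free_scale free_scale "tensor_act act x :: ('b list \<Rightarrow>\<^sub>0 'a) \<Rightarrow> _"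
    by (rule linear_tensor_act)
  let ?X = "{Poly_Mapping.single (us @ (v + w) # vs) 1
         - Poly_Mapping.single (us @ v # vs) 1 - Poly_Mapping.single (us @ w # vs) 1
        | us v w vs. length us + 1 + length vs = n} \<union>
      {Poly_Mapping.single (us @ scale c v # vs) 1
         - free_scale c (Poly_Mapping.single (us @ v # vs) 1)
        | us c v vs. length us + 1 + length vs = n} :: ('b list \<Rightarrow>\<^sub>0 'a) set"
  have "tensor_act act x p \<in> tensor_rel scale n" if "p \<in> ?X" for p
    using that
  proof
    assume "p \<in> {Poly_Mapping.single (us @ (v + w) # vs) 1
         - Poly_Mapping.single (us @ v # vs) 1 - Poly_Mapping.single (us @ w # vs) 1
        | us v w vs. length us + 1 + length vs = n}"
    then obtain us v w vs where n: "length us + 1 + length vs = n"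
      and p: "p = Poly_Mapping.single (us @ (v + w) # vs) 1
         - Poly_Mapping.single (us @ v # vs) 1 - Poly_Mapping.single (us @ w # vs) 1" by blast
    show ?thesis
      unfolding p using tensor_rel_add[of "map (act x) us" "map (act x) vs" n "act x v" "act x w"] n
      by (simp add: t.diff a.add)
  next
    assume "p \<in> {Poly_Mapping.single (us @ scale c v # vs) 1
         - free_scale c (Poly_Mapping.single (us @ v # vs) 1)
        | us c v vs. length us + 1 + length vs = n}"
    then obtain us c v vs where n: "length us + 1 + length vs = n"
      and p: "p = Poly_Mapping.single (us @ scale c v # vs) 1
         - free_scale c (Poly_Mapping.single (us @ v # vs) 1)" by blast
    show ?thesis
      unfolding p using tensor_rel_scale[of "map (act x) us" "map (act x) vs" n c "act x v"] n
      by (simp add: t.diff a.scale)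
  qed
  then have "tensor_act act x ` ?X \<subseteq> tensor_rel scale n" by blast
  then have "free.span (tensor_act act x ` ?X) \<subseteq> tensor_rel scale n"
    using subspace_tensor_rel by (rule free.span_minimal)
  then show ?thesis by (simp only: t.span_image tensor_rel_def)
qed

lemma tensor_act_tensor_free: "tensor_act act x ` tensor_free n \<subseteq> (tensor_free n :: ('b list \<Rightarrow>\<^sub>0 'a) set)"
proof -
  interpret t: Vector_Spaces.linear free_scale free_scale "tensor_act act x :: ('b list \<Rightarrow>\<^sub>0 'a) \<Rightarrow> _"
    by (rule linear_tensor_act)
  have "tensor_act act x ` {Poly_Mapping.single vs (1::'a) | vs. length vs = n} \<subseteq> tensor_free n"
    by (auto simp: tensor_free_def)
  then have "free.span (tensor_act act x ` {Poly_Mapping.single vs (1::'a) | vs. length vs = n}) \<subseteq> tensor_free n"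
    by (rule free.span_minimal) (rule subspace_tensor_free)
  then show ?thesis by (simp only: t.span_image tensor_free_eq_span)
qed

text \<open>Multilinear expansion of a pure tensor, entry by entry; the entries in \<open>us\<close> are already
  expanded.\<close>

lemma single_in_span_multilinear:
  assumes "set vs \<subseteq> span B" "length us + length vs = n"
  shows "Poly_Mapping.single (us @ vs) 1 \<in> free.span (tensor_rel scale n \<union>
    {Poly_Mapping.single (us @ bs) 1 | bs. set bs \<subseteq> B \<and> length bs = length vs})"
  using assms
proof (induction vs arbitrary: us)
  case Nil
  then show ?case by (intro free.span_base) auto
next
  case (Cons v vs)
  let ?L = "tensor_rel scale n"
  let ?X = "free.span (?L \<union>
    {Poly_Mapping.single (us @ bs) 1 | bs. set bs \<subseteq> B \<and> length bs = length (v # vs)})"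
  have n: "length us + 1 + length vs = n" using Cons.prems by simp
  have L: "p \<in> ?X" if "p \<in> ?L" for p using that by (intro free.span_base) simp
  have base: "Poly_Mapping.single (us @ b # vs) 1 \<in> ?X" if "b \<in> B" for b
  proof -
    have "Poly_Mapping.single ((us @ [b]) @ vs) 1 \<in> free.span (?L \<union>
      {Poly_Mapping.single ((us @ [b]) @ bs) 1 | bs. set bs \<subseteq> B \<and> length bs = length vs})"
      by (rule Cons.IH) (use Cons.prems in auto)
    moreover have "{Poly_Mapping.single ((us @ [b]) @ bs) (1::'a) | bs. set bs \<subseteq> B \<and> length bs = length vs}
        \<subseteq> {Poly_Mapping.single (us @ bs) 1 | bs. set bs \<subseteq> B \<and> length bs = length (v # vs)}"
    proof clarify
      fix bs assume bs: "set bs \<subseteq> B" "length bs = length vs"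
      then show "\<exists>cs. Poly_Mapping.single ((us @ [b]) @ bs) (1::'a) = Poly_Mapping.single (us @ cs) 1 \<and>
          set cs \<subseteq> B \<and> length cs = length (v # vs)"
        by (intro exI[of _ "b # bs"]) (use that in simp)
    qed
    ultimately show ?thesis
      using free.span_mono[of "?L \<union> {Poly_Mapping.single ((us @ [b]) @ bs) (1::'a) | bs. set bs \<subseteq> B \<and> length bs = length vs}"]
      by (simp only: append_assoc append_Cons append_Nil) (meson Un_mono order_refl subsetD)
  qed
  have "v \<in> span B" using Cons.prems by simp
  then show ?case
  proof (rule span_induct[where P = "\<lambda>v. Poly_Mapping.single (us @ v # vs) 1 \<in> ?X"])
    show "subspace {v. Poly_Mapping.single (us @ v # vs) 1 \<in> ?X}"
    proof (rule subspaceI)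
      have sc: "Poly_Mapping.single (us @ scale c x # vs) 1 \<in> ?X"
        if "Poly_Mapping.single (us @ x # vs) 1 \<in> ?X" for c x
      proof -
        have "(Poly_Mapping.single (us @ scale c x # vs) 1
            - free_scale c (Poly_Mapping.single (us @ x # vs) 1))
            + free_scale c (Poly_Mapping.single (us @ x # vs) 1) \<in> ?X"
          by (rule free.span_add[OF L[OF tensor_rel_scale[OF n]] free.span_scale[OF that]])
        then show ?thesis by (simp only: diff_add_cancel)
      qed
      have "Poly_Mapping.single (us @ scale 0 0 # vs) 1 - free_scale 0 (Poly_Mapping.single (us @ 0 # vs) 1) \<in> ?X"
        by (intro L tensor_rel_scale n)
      then show "0 \<in> {v. Poly_Mapping.single (us @ v # vs) 1 \<in> ?X}" by simp
      fix x y c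
      assume x: "x \<in> {v. Poly_Mapping.single (us @ v # vs) 1 \<in> ?X}"
      then show "scale c x \<in> {v. Poly_Mapping.single (us @ v # vs) 1 \<in> ?X}" using sc by blast
      assume y: "y \<in> {v. Poly_Mapping.single (us @ v # vs) 1 \<in> ?X}"
      have "(Poly_Mapping.single (us @ (x + y) # vs) 1 - Poly_Mapping.single (us @ x # vs) 1
        - Poly_Mapping.single (us @ y # vs) 1) + (Poly_Mapping.single (us @ x # vs) 1
        + Poly_Mapping.single (us @ y # vs) 1) \<in> ?X"
        using x y by (intro free.span_add[OF L[OF tensor_rel_add[OF n]] free.span_add]) simp_all
      then show "x + y \<in> {v. Poly_Mapping.single (us @ v # vs) 1 \<in> ?X}" by simp
    qed
  qed (use base in simp)
qed

end

context finite_dimensional_vector_space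
begin

definition basis_tensors :: "nat \<Rightarrow> ('b list \<Rightarrow>\<^sub>0 'a) set" where
  "basis_tensors n = (\<lambda>bs. Poly_Mapping.single bs 1) ` {bs. set bs \<subseteq> Basis \<and> length bs = n}"

lemma finite_basis_tensors [simp]: "finite (basis_tensors n)"
  by (simp add: basis_tensors_def finite_lists_length_eq finite_Basis)

lemma card_basis_tensors: "card (basis_tensors n) = card Basis ^ n"
proof -
  have "inj (\<lambda>bs :: 'b list. Poly_Mapping.single bs (1::'a))"
    by (rule injI) (metis lookup_single_eq lookup_single_not_eq zero_neq_one)
  then show ?thesis
    by (simp add: basis_tensors_def card_image inj_on_subset[OF _ subset_UNIV] card_lists_length_eq finite_Basis)
qed

lemma tensor_free_subset_span:
  "tensor_free n \<subseteq> free.span (tensor_rel scale n \<union> basis_tensors n)"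
  unfolding tensor_free_eq_span
proof (rule free.span_minimal)
  show "{Poly_Mapping.single vs 1 | vs. length vs = n} \<subseteq> free.span (tensor_rel scale n \<union> basis_tensors n)"
  proof clarify
    fix vs :: "'b list" assume "n = length vs"
    then have "Poly_Mapping.single ([] @ vs) 1 \<in> free.span (tensor_rel scale n \<union>
      {Poly_Mapping.single ([] @ bs) 1 | bs. set bs \<subseteq> Basis \<and> length bs = length vs})"
      by (intro single_in_span_multilinear) (simp_all add: span_Basis)
    moreover have "{Poly_Mapping.single ([] @ bs) 1 | bs. set bs \<subseteq> Basis \<and> length bs = length vs}
      = basis_tensors (length vs)" by (auto simp: basis_tensors_def)
    ultimately show "Poly_Mapping.single vs 1 \<in> free.span (tensor_rel scale (length vs) \<union> basis_tensors (length vs))"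
      using \<open>n = length vs\<close> by simp
  qed
qed simp

definition tensor_coord :: "nat \<Rightarrow> 'b list \<Rightarrow> 'b list \<Rightarrow> 'a" where
  "tensor_coord n vs bs = (\<Prod>j<n. representation Basis (vs ! j) (bs ! j))"

text \<open>This isolates one entry, in which the coordinate is visibly linear.\<close>

lemma tensor_coord_slot:
  assumes "length us + 1 + length vs = n"
  shows "tensor_coord n (us @ x # vs) bs = representation Basis x (bs ! length us) *
    (\<Prod>j\<in>{..<n} - {length us}. representation Basis ((us @ 0 # vs) ! j) (bs ! j))"
proof -
  have "tensor_coord n (us @ x # vs) bs = representation Basis ((us @ x # vs) ! length us) (bs ! length us) *
    (\<Prod>j\<in>{..<n} - {length us}. representation Basis ((us @ x # vs) ! j) (bs ! j))"
    unfolding tensor_coord_def by (rule prod.remove) (use assms in auto)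
  also have "(\<Prod>j\<in>{..<n} - {length us}. representation Basis ((us @ x # vs) ! j) (bs ! j)) =
    (\<Prod>j\<in>{..<n} - {length us}. representation Basis ((us @ 0 # vs) ! j) (bs ! j))"
    by (rule prod.cong) (auto simp: nth_append nth_Cons')
  finally show ?thesis by simp
qed

text \<open>On the free space on \<open>n\<close>-tuples, the projection along the relations onto the span of the
  basis tensors. It shows that the basis tensors stay independent in the tensor power.\<close>

definition tensor_expansion :: "nat \<Rightarrow> ('b list \<Rightarrow>\<^sub>0 'a) \<Rightarrow> ('b list \<Rightarrow>\<^sub>0 'a)" where
  "tensor_expansion n = linear_extension (\<lambda>vs. \<Sum>bs | set bs \<subseteq> Basis \<and> length bs = n.
     Poly_Mapping.single bs (tensor_coord n vs bs))"

lemma tensor_expansion_single: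
  "tensor_expansion n (Poly_Mapping.single vs 1) = (\<Sum>bs | set bs \<subseteq> Basis \<and> length bs = n.
     Poly_Mapping.single bs (tensor_coord n vs bs))"
  by (simp add: tensor_expansion_def)

lemma tensor_expansion_basis:
  assumes "set cs \<subseteq> Basis" "length cs = n"
  shows "tensor_expansion n (Poly_Mapping.single cs 1) = Poly_Mapping.single cs 1"
proof -
  have "tensor_coord n cs bs = (if bs = cs then 1 else 0)" if bs: "set bs \<subseteq> Basis" "length bs = n" for bs
  proof (cases "bs = cs")
    case True
    have "representation Basis (cs ! j) (cs ! j) = 1" if "j < n" for j
    proof -
      have "cs ! j \<in> Basis" using assms that nth_mem by blast
      then show ?thesis by (simp add: representation_basis independent_Basis)
    qed
    then show ?thesis using True by (simp add: tensor_coord_def)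
  next
    case False
    then obtain j where j: "j < n" "bs ! j \<noteq> cs ! j" using assms bs by (metis nth_equalityI)
    have "cs ! j \<in> Basis" using assms j nth_mem by blast
    then have "representation Basis (cs ! j) (bs ! j) = 0"
      using j by (simp add: representation_basis independent_Basis)
    then show ?thesis using False j by (auto simp: tensor_coord_def)
  qed
  then have "tensor_expansion n (Poly_Mapping.single cs 1) =
      (\<Sum>bs | set bs \<subseteq> Basis \<and> length bs = n. if bs = cs then Poly_Mapping.single cs 1 else 0)"
    unfolding tensor_expansion_single by (intro sum.cong) auto
  then show ?thesis using assms by (simp add: finite_lists_length_eq finite_Basis)
qed

lemma tensor_expansion_tensor_rel:
  assumes "p \<in> tensor_rel scale n"
  shows "tensor_expansion n p = 0"
proof -
  interpret t: Vector_Spaces.linear free_scale free_scale "tensor_expansion n"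
    unfolding tensor_expansion_def by (rule linear_linear_extension)
  have add: "tensor_expansion n (Poly_Mapping.single (us @ (v + w) # vs) 1
         - Poly_Mapping.single (us @ v # vs) 1 - Poly_Mapping.single (us @ w # vs) 1) = 0"
    if "length us + 1 + length vs = n" for us v w vs
  proof -
    have "tensor_coord n (us @ (v + w) # vs) bs =
        tensor_coord n (us @ v # vs) bs + tensor_coord n (us @ w # vs) bs" for bs
      unfolding tensor_coord_slot[OF that]
      by (simp add: representation_add[OF independent_Basis] span_Basis algebra_simps)
    then show ?thesis
      by (simp add: t.diff tensor_expansion_single single_add sum.distrib)
  qed
  have sc: "tensor_expansion n (Poly_Mapping.single (us @ scale c v # vs) 1
         - free_scale c (Poly_Mapping.single (us @ v # vs) 1)) = 0"
    if "length us + 1 + length vs = n" for us c v vs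
  proof -
    have "tensor_coord n (us @ scale c v # vs) bs = c * tensor_coord n (us @ v # vs) bs" for bs
      unfolding tensor_coord_slot[OF that]
      by (simp add: representation_scale[OF independent_Basis] span_Basis algebra_simps)
    moreover have "tensor_expansion n (free_scale c (Poly_Mapping.single (us @ v # vs) 1)) =
        free_scale c (tensor_expansion n (Poly_Mapping.single (us @ v # vs) 1))"
      by (rule t.scale)
    ultimately show ?thesis
      by (simp only: t.diff tensor_expansion_single free.scale_sum_right free_scale_single diff_self)
  qed
  show ?thesis
    by (rule t.eq_0_on_span[OF _ assms[unfolded tensor_rel_def]]) (use add sc in blast)
qed

text \<open>The lower bound for the dimension of the tensor power.\<close>

lemma card_Basis_power_le:
  assumes "tensor_free n \<subseteq> free.span (tensor_rel scale n \<union> S)" "finite S"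
  shows "card Basis ^ n \<le> card S"
proof -
  interpret t: Vector_Spaces.linear free_scale free_scale "tensor_expansion n"
    unfolding tensor_expansion_def by (rule linear_linear_extension)
  have basis: "tensor_expansion n p = p" if "p \<in> basis_tensors n" for p
    using that by (auto simp: basis_tensors_def tensor_expansion_basis)
  have "basis_tensors n \<subseteq> tensor_free n" by (auto simp: basis_tensors_def tensor_free_def)
  then have "basis_tensors n \<subseteq> tensor_expansion n ` free.span (tensor_rel scale n \<union> S)"
    using basis assms(1) by (metis (no_types, lifting) image_eqI subset_iff)
  also have "\<dots> = free.span (tensor_expansion n ` (tensor_rel scale n \<union> S))"
    by (rule t.span_image[symmetric])
  also have "\<dots> \<subseteq> free.span (tensor_expansion n ` S)"
    by (rule free.span_minimal)
      (auto simp: tensor_expansion_tensor_rel intro: free.span_base free.span_zero)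
  finally have sub: "basis_tensors n \<subseteq> free.span (tensor_expansion n ` S)" .
  have "free.independent (basis_tensors n)"
  proof (rule free.independent_if_scalars_zero)
    fix f :: "('b list \<Rightarrow>\<^sub>0 'a) \<Rightarrow> 'a" and p
    assume sum: "(\<Sum>p\<in>basis_tensors n. free_scale (f p) p) = 0" and p: "p \<in> basis_tensors n"
    then obtain bs where bs: "p = Poly_Mapping.single bs 1" by (auto simp: basis_tensors_def)
    have "0 = Poly_Mapping.lookup (\<Sum>p\<in>basis_tensors n. free_scale (f p) p) bs" by (simp add: sum)
    also have "\<dots> = (\<Sum>q\<in>basis_tensors n. f q * Poly_Mapping.lookup q bs)" by (simp add: lookup_sum)
    also have "\<dots> = (\<Sum>q\<in>basis_tensors n. if q = p then f p else 0)"
    proof (rule sum.cong)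
      fix q assume "q \<in> basis_tensors n"
      then obtain cs where "q = Poly_Mapping.single cs 1" by (auto simp: basis_tensors_def)
      then show "f q * Poly_Mapping.lookup q bs = (if q = p then f p else 0)"
        unfolding bs by (cases "cs = bs")
          (auto simp: lookup_single_not_eq dest: arg_cong[of _ _ "\<lambda>q. Poly_Mapping.lookup q cs"])
    qed simp
    finally show "f p = 0" using p by simp
  qed simp
  then have "card (basis_tensors n) \<le> card (tensor_expansion n ` S)"
    using free.independent_span_bound[of "tensor_expansion n ` S" "basis_tensors n"] sub assms(2) by simp
  then show ?thesis using card_image_le[OF assms(2), of "tensor_expansion n"] card_basis_tensors by simp
qed

end

section \<open>Tensors with entries in a proper subspace\<close>

lemma sum_bool_lists_Suc:
  "(\<Sum>bl | length bl = Suc n. g bl) =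
    (\<Sum>bl | length bl = n. g (False # bl) + (g (True # bl) :: 'a::comm_monoid_add))"
proof -
  let ?A = "\<lambda>n. {bl :: bool list. length bl = n}"
  have fin: "finite (?A n)"
    using finite_lists_length_eq[of "UNIV :: bool set" n] by simp
  have "?A (Suc n) = (#) False ` ?A n \<union> (#) True ` ?A n"
    by (auto simp: length_Suc_conv)
  then have "(\<Sum>bl\<in>?A (Suc n). g bl) = (\<Sum>bl\<in>(#) False ` ?A n. g bl) + (\<Sum>bl\<in>(#) True ` ?A n. g bl)"
    using fin by (simp only:) (rule sum.union_disjoint, auto)
  then show ?thesis
    by (simp add: sum.reindex sum.distrib)
qed

text \<open>In the product of the vectors \<open>b + c b p\<close> over the entries \<open>b\<close> of a list, each term chooses
  \<open>b\<close> or \<open>c b p\<close> in every slot. A Boolean list records the choices, with \<open>True\<close> (a marked slot)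
  for \<open>c b p\<close>; the multiset of the marked \<open>b\<close> then determines the scalar in front of the term.\<close>

definition replace_marked :: "'b \<Rightarrow> 'b list \<Rightarrow> bool list \<Rightarrow> 'b list" where
  "replace_marked p bs bl = map2 (\<lambda>b x. if x then p else b) bs bl"

definition marked :: "'b list \<Rightarrow> bool list \<Rightarrow> 'b multiset" where
  "marked bs bl = mset (map fst (filter snd (zip bs bl)))"

text \<open>The coefficient of the monomial belonging to \<open>\<alpha>\<close> when the product is seen as a polynomial in
  the scalars \<open>c b\<close>.\<close>

definition sheared :: "'b \<Rightarrow> 'b list \<Rightarrow> 'b multiset \<Rightarrow> ('b list \<Rightarrow>\<^sub>0 'k::field)" where
  "sheared p bs \<alpha> =
     (\<Sum>bl | length bl = length bs \<and> marked bs bl = \<alpha>. Poly_Mapping.single (replace_marked p bs bl) 1)"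

lemma card_small_multisets:
  assumes "finite B"
  shows "finite {\<alpha>. set_mset \<alpha> \<subseteq> B \<and> size \<alpha> \<le> n}" (is "finite ?M")
    and "card {\<alpha>. set_mset \<alpha> \<subseteq> B \<and> size \<alpha> \<le> n} \<le> (n + 1) ^ card B"
proof -
  let ?f = "\<lambda>\<alpha>. restrict (count \<alpha>) B"
  have inj: "inj_on ?f ?M"
  proof (rule inj_onI, rule multiset_eqI)
    fix \<alpha> \<beta> x assume a: "\<alpha> \<in> ?M" "\<beta> \<in> ?M" "?f \<alpha> = ?f \<beta>"
    show "count \<alpha> x = count \<beta> x"
    proof (cases "x \<in> B")
      case True
      then show ?thesis using fun_cong[OF a(3), of x] by simp
    next
      case False
      then have "x \<notin># \<alpha>" "x \<notin># \<beta>" using a by auto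
      then show ?thesis by (simp add: not_in_iff)
    qed
  qed
  have sub: "?f ` ?M \<subseteq> PiE B (\<lambda>_. {0..n})"
    using count_le_size le_trans by fastforce
  have fin: "finite (PiE B (\<lambda>_. {0..n}))" using assms by (simp add: finite_PiE)
  show "finite ?M" using inj sub fin by (meson finite_imageD finite_subset)
  have "card ?M = card (?f ` ?M)" using inj by (simp add: card_image)
  also have "\<dots> \<le> card (PiE B (\<lambda>_. {0..n}))" by (rule card_mono[OF fin sub])
  also have "\<dots> = (n + 1) ^ card B" using assms by (simp add: card_PiE)
  finally show "card ?M \<le> (n + 1) ^ card B" .
qed

context vector_space
begin

lemma single_shear_expansion:
  assumes "length us + length bs = n"
  shows "Poly_Mapping.single (us @ map (\<lambda>b. b + scale (c b) p) bs) 1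
    - (\<Sum>bl | length bl = length bs. free_scale (prod_mset (image_mset c (marked bs bl)))
         (Poly_Mapping.single (us @ replace_marked p bs bl) 1)) \<in> tensor_rel scale n"
  using assms
proof (induction bs arbitrary: us)
  case Nil
  have "{bl :: bool list. length bl = length []} = {[]}" by auto
  then show ?case
    by (simp add: marked_def replace_marked_def free.subspace_0 subspace_tensor_rel)
next
  case (Cons b bs)
  let ?L = "tensor_rel scale n"
  let ?ws = "map (\<lambda>b. b + scale (c b) p) bs"
  define e :: "'b list \<Rightarrow> ('b list \<Rightarrow>\<^sub>0 'a)" where "e ws = Poly_Mapping.single ws 1" for ws
  define w where "w bl = prod_mset (image_mset c (marked bs bl))" for bl
  define X where "X us = (\<Sum>bl | length bl = length bs. free_scale (w bl) (e (us @ replace_marked p bs bl)))" for us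
  have n: "length us + 1 + length ?ws = n" using Cons.prems by simp
  have IH: "e ((us @ [x]) @ ?ws) - X (us @ [x]) \<in> ?L" for x
    using Cons.IH[of "us @ [x]"] Cons.prems by (simp add: e_def X_def w_def)
  have split: "(\<Sum>bl | length bl = length (b # bs). free_scale (prod_mset (image_mset c (marked (b # bs) bl)))
         (e (us @ replace_marked p (b # bs) bl))) = X (us @ [b]) + free_scale (c b) (X (us @ [p]))"
    by (simp add: sum_bool_lists_Suc marked_def replace_marked_def X_def w_def sum.distrib
        free.scale_sum_right)
  \<comment> \<open>both relations for the first entry and both induction hypotheses; their sum telescopes\<close>
  have "(e (us @ (b + scale (c b) p) # ?ws) - e (us @ b # ?ws) - e (us @ scale (c b) p # ?ws))
      + (e (us @ scale (c b) p # ?ws) - free_scale (c b) (e (us @ p # ?ws)))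
      + (e ((us @ [b]) @ ?ws) - X (us @ [b])) + free_scale (c b) (e ((us @ [p]) @ ?ws) - X (us @ [p])) \<in> ?L"
    unfolding e_def
    by (intro free.subspace_add[OF subspace_tensor_rel] free.subspace_scale[OF subspace_tensor_rel]
        tensor_rel_add[OF n] tensor_rel_scale[OF n] IH[unfolded e_def])
  then have "e (us @ (b + scale (c b) p) # ?ws) - (X (us @ [b]) + free_scale (c b) (X (us @ [p]))) \<in> ?L"
    by (simp add: free.scale_right_diff_distrib algebra_simps)
  then show ?case unfolding split[symmetric] by (simp add: e_def)
qed

text \<open>The vectors on the right do not depend on \<open>c\<close>, and there are only polynomially many of them:
  this is what makes the tensors from all hyperplanes together span a small space.\<close>

lemma single_shear_in_span:
  assumes "length bs = n"
  shows "Poly_Mapping.single (map (\<lambda>b. b + scale (c b) p) bs) 1 \<in> free.span (tensor_rel scale n \<union>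
    sheared p bs ` {\<alpha>. set_mset \<alpha> \<subseteq> set bs \<and> size \<alpha> \<le> n})"
proof -
  let ?X = "free.span (tensor_rel scale n \<union> sheared p bs ` {\<alpha>. set_mset \<alpha> \<subseteq> set bs \<and> size \<alpha> \<le> n})"
  let ?w = "\<lambda>\<alpha>. prod_mset (image_mset c \<alpha>)"
  let ?A = "{bl :: bool list. length bl = length bs}"
  have fin: "finite ?A" using finite_lists_length_eq[of "UNIV :: bool set"] by simp
  have "(\<Sum>bl\<in>?A. free_scale (?w (marked bs bl)) (Poly_Mapping.single (replace_marked p bs bl) 1)) =
      (\<Sum>\<alpha>\<in>marked bs ` ?A. \<Sum>bl | bl \<in> ?A \<and> marked bs bl = \<alpha>.
        free_scale (?w (marked bs bl)) (Poly_Mapping.single (replace_marked p bs bl) 1))"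
    by (rule sum.image_gen[OF fin])
  also have "\<dots> = (\<Sum>\<alpha>\<in>marked bs ` ?A. free_scale (?w \<alpha>) (sheared p bs \<alpha>))"
    by (rule sum.cong) (simp_all add: sheared_def free.scale_sum_right)
  also have "\<dots> \<in> ?X"
  proof (intro free.span_sum free.span_scale free.span_base UnI2 imageI)
    fix \<alpha> assume "\<alpha> \<in> marked bs ` ?A"
    then obtain bl where bl: "length bl = length bs" "\<alpha> = marked bs bl" by auto
    have "size \<alpha> = length (filter snd (zip bs bl))"
      by (simp only: bl marked_def size_mset length_map)
    also have "\<dots> \<le> length (zip bs bl)" by (rule length_filter_le)
    finally have "size \<alpha> \<le> n" using assms by simp
    then show "\<alpha> \<in> {\<alpha>. set_mset \<alpha> \<subseteq> set bs \<and> size \<alpha> \<le> n}"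
      by (auto simp: bl(2) marked_def dest: set_zip_leftD)
  qed
  finally have "(\<Sum>bl\<in>?A. free_scale (?w (marked bs bl)) (Poly_Mapping.single (replace_marked p bs bl) 1)) \<in> ?X" .
  moreover have "Poly_Mapping.single (map (\<lambda>b. b + scale (c b) p) bs) 1
    - (\<Sum>bl\<in>?A. free_scale (?w (marked bs bl)) (Poly_Mapping.single (replace_marked p bs bl) 1)) \<in> ?X"
    using single_shear_expansion[of "[]" bs n c p] assms by (intro free.span_base UnI1) simp
  ultimately show ?thesis using free.span_add by fastforce
qed

end

context finite_dimensional_vector_space
begin

text \<open>\<open>X\<close> lies in the kernel of a nonzero functional \<open>g\<close>. For a basis vector \<open>p\<close> with
  \<open>g p \<noteq> 0\<close>, the kernel is spanned by the vectors \<open>b - (g b / g p) p\<close>.\<close>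

lemma proper_subspace_shear:
  assumes "span X \<noteq> UNIV"
  obtains p c where "p \<in> Basis" "X \<subseteq> span ((\<lambda>b. b + scale (c b) p) ` (Basis - {p}))"
proof -
  interpret f: vector_space "(*) :: 'a \<Rightarrow> 'a \<Rightarrow> 'a" by unfold_locales (auto simp: algebra_simps)
  interpret vp: vector_space_pair scale "(*) :: 'a \<Rightarrow> 'a \<Rightarrow> 'a" ..
  obtain C where C: "C \<subseteq> X" "independent C" "X \<subseteq> span C"
    by (rule maximal_independent_subset)
  have "span C = span X" using C by (metis span_eq span_superset subset_trans)
  then obtain v where v: "v \<notin> span C" using assms by auto
  then have "independent (insert v C)" using C independent_insertI by blast
  then obtain g where g: "Vector_Spaces.linear scale (*) g"
      "\<forall>x\<in>insert v C. g x = (if x = v then 1 else 0)"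
    using vp.linear_independent_extend[of "insert v C" "\<lambda>x. if x = v then 1 else 0"] by blast
  interpret g: Vector_Spaces.linear scale "(*)" g by fact
  have "v \<notin> C" using v span_base by blast
  then have "g x = 0" if "x \<in> C" for x using g(2) that by auto
  then have gX: "g x = 0" if "x \<in> X" for x using g.eq_0_on_span[of C x] C that by blast
  have "g v = 1" using g(2) by simp
  then have "\<exists>p\<in>Basis. g p \<noteq> 0" using g.eq_0_on_span[of Basis v] by (auto simp: span_Basis)
  then obtain p where p: "p \<in> Basis" "g p \<noteq> 0" by blast
  define c where "c b = - (g b / g p)" for b
  let ?f = "\<lambda>b. b + scale (c b) p"
  let ?Y = "span (?f ` (Basis - {p}))"
  have gf: "g (?f b) = 0" for b using p by (simp add: g.diff g.scale c_def)
  have "\<exists>y\<in>?Y. \<exists>k. x = y + scale k p" for x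
  proof -
    have "x \<in> span Basis" by (simp add: span_Basis)
    then show ?thesis
    proof (induction rule: span_induct_alt)
      case base
      show ?case by (intro bexI[of _ 0] exI[of _ 0]) (simp_all add: span_zero)
    next
      case (step a b z)
      then obtain y k where yk: "y \<in> ?Y" "z = y + scale k p" by blast
      show ?case
      proof (cases "b = p")
        case True
        then have "scale a b + z = y + scale (a + k) p" by (simp add: yk scale_left_distrib)
        then show ?thesis using yk by blast
      next
        case False
        then have "?f b \<in> ?Y" using step by (intro span_base) blast
        then have "scale a (?f b) + y \<in> ?Y" using yk(1) span_add span_scale by blast
        moreover have "scale a b + z = (scale a (?f b) + y) + scale (k - a * c b) p"
          by (simp add: yk scale_right_distrib scale_left_diff_distrib)
        ultimately show ?thesis by blast
      qed
    qed
  qed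
  then have "x \<in> ?Y" if x: "x \<in> X" for x
  proof -
    obtain y k where yk: "y \<in> ?Y" "x = y + scale k p"
      using \<open>\<And>x. \<exists>y\<in>?Y. \<exists>k. x = y + scale k p\<close> by blast
    have "g y = 0" by (rule g.eq_0_on_span[OF _ yk(1)]) (use gf in auto)
    then have "k * g p = 0" using gX[OF x] yk(2) by (simp add: g.add g.scale)
    then show ?thesis using yk p by simp
  qed
  then show ?thesis using that p by blast
qed

definition degenerate_tensors :: "nat \<Rightarrow> ('b list \<Rightarrow>\<^sub>0 'a) set" where
  "degenerate_tensors n = free.span (tensor_rel scale n \<union>
     {Poly_Mapping.single ws 1 | ws. length ws = n \<and> span (set ws) \<noteq> UNIV})"

text \<open>The three factors count the vectors \<open>p\<close>, the lists over the other \<open>d - 1\<close> basis vectors, and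
  the monomials.\<close>

lemma degenerate_tensors_bound:
  obtains S where "finite S" "degenerate_tensors n \<subseteq> free.span (tensor_rel scale n \<union> S)"
    "card S \<le> card Basis * (card Basis - 1) ^ n * (n + 1) ^ card Basis"
proof -
  define I where "I = (SIGMA p:Basis. {bs. set bs \<subseteq> Basis - {p} \<and> length bs = n}
    \<times> {\<alpha>. set_mset \<alpha> \<subseteq> Basis \<and> size \<alpha> \<le> n})"
  define S :: "('b list \<Rightarrow>\<^sub>0 'a) set" where "S = (\<lambda>(p, bs, \<alpha>). sheared p bs \<alpha>) ` I"
  have fin: "finite {bs. set bs \<subseteq> Basis - {p} \<and> length bs = n}" for p
    by (rule finite_lists_length_eq) (simp add: finite_Basis)
  note ms = card_small_multisets[OF finite_Basis, of n]
  have finI: "finite I" unfolding I_def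
    by (intro finite_SigmaI finite_Basis finite_cartesian_product fin ms)
  have "card S \<le> card I" unfolding S_def by (rule card_image_le[OF finI])
  also have "card I = (\<Sum>p\<in>Basis. card {bs. set bs \<subseteq> Basis - {p} \<and> length bs = n}
      * card {\<alpha>. set_mset \<alpha> \<subseteq> Basis \<and> size \<alpha> \<le> n})"
    unfolding I_def by (simp add: card_SigmaI finite_Basis fin ms(1) card_cartesian_product)
  also have "\<dots> \<le> (\<Sum>p\<in>Basis. (card Basis - 1) ^ n * (n + 1) ^ card Basis)"
    by (rule sum_mono, rule mult_mono) (use ms(2) in \<open>auto simp: card_lists_length_eq finite_Basis\<close>)
  also have "\<dots> = card Basis * (card Basis - 1) ^ n * (n + 1) ^ card Basis" by simp
  finally have "card S \<le> card Basis * (card Basis - 1) ^ n * (n + 1) ^ card Basis" .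
  moreover have "finite S" using finI by (simp add: S_def)
  moreover have "degenerate_tensors n \<subseteq> free.span (tensor_rel scale n \<union> S)"
    unfolding degenerate_tensors_def
  proof (rule free.span_minimal[OF _ free.subspace_span], rule subsetI)
    let ?X = "free.span (tensor_rel scale n \<union> S)"
    fix q assume "q \<in> tensor_rel scale n \<union>
      {Poly_Mapping.single ws 1 | ws. length ws = n \<and> span (set ws) \<noteq> UNIV}"
    then show "q \<in> ?X"
    proof
      assume "q \<in> {Poly_Mapping.single ws 1 | ws. length ws = n \<and> span (set ws) \<noteq> UNIV}"
      then obtain ws where ws: "q = Poly_Mapping.single ws 1" "length ws = n" "span (set ws) \<noteq> UNIV"
        by blast
      obtain p c where p: "p \<in> Basis" and
        sub: "set ws \<subseteq> span ((\<lambda>b. b + scale (c b) p) ` (Basis - {p}))"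
        by (rule proper_subspace_shear[OF ws(3)])
      let ?f = "\<lambda>b. b + scale (c b) p"
      let ?Y = "{Poly_Mapping.single ([] @ cs) (1::'a) | cs. set cs \<subseteq> ?f ` (Basis - {p}) \<and> length cs = length ws}"
      have "?Y \<subseteq> ?X"
      proof (rule subsetI)
        fix r assume "r \<in> ?Y"
        then obtain cs where cs: "r = Poly_Mapping.single cs 1" "set cs \<subseteq> ?f ` (Basis - {p})" "length cs = n"
          using ws(2) by auto
        then have "cs \<in> lists (?f ` (Basis - {p}))" by auto
        then obtain bs where bs: "cs = map ?f bs" "set bs \<subseteq> Basis - {p}"
          unfolding lists_image by auto
        have "r \<in> free.span (tensor_rel scale n \<union>
            sheared p bs ` {\<alpha>. set_mset \<alpha> \<subseteq> set bs \<and> size \<alpha> \<le> n})"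
          unfolding cs(1) bs(1) by (rule single_shear_in_span) (use bs cs in simp)
        also have "\<dots> \<subseteq> ?X"
        proof (rule free.span_mono, rule Un_mono[OF order_refl], rule image_subsetI)
          fix \<alpha> assume "\<alpha> \<in> {\<alpha>. set_mset \<alpha> \<subseteq> set bs \<and> size \<alpha> \<le> n}"
          then have "(p, bs, \<alpha>) \<in> I" using p bs cs by (auto simp: I_def)
          then show "sheared p bs \<alpha> \<in> S" unfolding S_def by (rule rev_image_eqI) simp
        qed
        finally show "r \<in> ?X" .
      qed
      then have "tensor_rel scale n \<union> ?Y \<subseteq> ?X"
        by (intro Un_least) (auto intro: free.span_base)
      then have "free.span (tensor_rel scale n \<union> ?Y) \<subseteq> ?X"
        by (rule free.span_minimal) simp
      moreover have "q \<in> free.span (tensor_rel scale n \<union> ?Y)"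
        using single_in_span_multilinear[OF sub, of "[]" n] ws by simp
      ultimately show ?thesis by blast
    qed (auto intro: free.span_base)
  qed
  ultimately show ?thesis using that by blast
qed

text \<open>A linear map that sends a proper subspace onto \<open>V\<close> would be surjective, hence injective, hence
  could not.\<close>

lemma tensor_act_degenerate:
  assumes lin: "Vector_Spaces.linear scale scale (act x)"
  shows "tensor_act act x ` degenerate_tensors n \<subseteq> degenerate_tensors n"
proof -
  interpret a: Vector_Spaces.linear scale scale "act x" by fact
  interpret t: Vector_Spaces.linear free_scale free_scale "tensor_act act x :: ('b list \<Rightarrow>\<^sub>0 'a) \<Rightarrow> _"
    by (rule linear_tensor_act)
  have "tensor_act act x q \<in> degenerate_tensors n"
    if "q \<in> {Poly_Mapping.single ws 1 | ws. length ws = n \<and> span (set ws) \<noteq> UNIV}" for q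
  proof -
    obtain ws where ws: "q = Poly_Mapping.single ws 1" "length ws = n" "span (set ws) \<noteq> UNIV"
      using \<open>q \<in> _\<close> by blast
    have "act x ` span (set ws) \<noteq> UNIV"
    proof
      assume full: "act x ` span (set ws) = UNIV"
      then have "surj (act x)" by auto
      then have "inj (act x)" using linear_surj_imp_inj lin by blast
      have "v \<in> span (set ws)" for v
      proof -
        have "act x v \<in> act x ` span (set ws)" using full by simp
        then show ?thesis using \<open>inj (act x)\<close> by (auto dest: injD)
      qed
      then show False using ws by auto
    qed
    then have "span (set (map (act x) ws)) \<noteq> UNIV" by (simp add: a.span_image)
    then show ?thesis unfolding degenerate_tensors_def
      using ws by (intro free.span_base UnI2) auto
  qed
  moreover have "tensor_act act x ` tensor_rel scale n \<subseteq> degenerate_tensors n"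
    using tensor_act_tensor_rel[where act = act and x = x and n = n, OF lin] by (auto simp: degenerate_tensors_def intro: free.span_base)
  ultimately have "tensor_act act x ` (tensor_rel scale n \<union>
     {Poly_Mapping.single ws 1 | ws. length ws = n \<and> span (set ws) \<noteq> UNIV}) \<subseteq> degenerate_tensors n"
    unfolding image_Un by blast
  then have "free.span (tensor_act act x ` (tensor_rel scale n \<union>
     {Poly_Mapping.single ws 1 | ws. length ws = n \<and> span (set ws) \<noteq> UNIV})) \<subseteq> degenerate_tensors n"
    by (rule free.span_minimal) (simp add: degenerate_tensors_def)
  then show ?thesis by (simp only: t.span_image degenerate_tensors_def)
qed

lemma tensor_act_noninvertible:
  assumes lin: "Vector_Spaces.linear scale scale (act x)" and "\<not> bij (act x)"
  shows "tensor_act act x ` tensor_free n \<subseteq> degenerate_tensors n"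
proof -
  interpret a: Vector_Spaces.linear scale scale "act x" by fact
  interpret t: Vector_Spaces.linear free_scale free_scale "tensor_act act x :: ('b list \<Rightarrow>\<^sub>0 'a) \<Rightarrow> _"
    by (rule linear_tensor_act)
  have "range (act x) \<noteq> UNIV" using assms linear_surj_imp_inj by (auto simp: bij_def)
  moreover have "span (range (act x)) = range (act x)"
    using a.span_image[of UNIV] by simp
  moreover have "span (set (map (act x) vs)) \<subseteq> span (range (act x))" for vs
    by (rule span_mono) auto
  ultimately have "span (set (map (act x) vs)) \<noteq> UNIV" for vs by (metis top.extremum_unique)
  then have "tensor_act act x ` {Poly_Mapping.single vs (1::'a) | vs. length vs = n} \<subseteq> degenerate_tensors n"
    unfolding degenerate_tensors_def by (fastforce intro: free.span_base)
  then have "free.span (tensor_act act x ` {Poly_Mapping.single vs (1::'a) | vs. length vs = n}) \<subseteq> degenerate_tensors n"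
    by (rule free.span_minimal) (simp add: degenerate_tensors_def)
  then show ?thesis by (simp only: t.span_image tensor_free_eq_span)
qed

end

section \<open>Counting the composition factors of a tensor power\<close>

text \<open>\<open>A\<close> plays the role of a commutative subgroup and \<open>T\<close> of representatives of its finitely many
  left cosets.\<close>

definition virtually_commutative_units :: "'a monoid \<Rightarrow> 'a set \<Rightarrow> 'a set \<Rightarrow> bool" where
  "virtually_commutative_units M T A \<longleftrightarrow>
     finite T \<and> T \<subseteq> Units M \<and> A \<subseteq> Units M \<and> \<one>\<^bsub>M\<^esub> \<in> Units M \<and>
     (\<forall>g\<in>Units M. \<forall>h\<in>Units M. g \<otimes>\<^bsub>M\<^esub> h \<in> Units M) \<and>
     (\<forall>g\<in>Units M. \<exists>t\<in>T. \<exists>a\<in>A. g = t \<otimes>\<^bsub>M\<^esub> a) \<and>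
     (\<forall>a\<in>A. \<forall>b\<in>A. a \<otimes>\<^bsub>M\<^esub> b = b \<otimes>\<^bsub>M\<^esub> a)"

text \<open>The generators are the images under \<open>T\<close> of a common eigenvector of \<open>A\<close>. Modulo \<open>Ws ! i\<close>
  they span a space that is stable under the units since every unit is some \<open>t \<otimes> a\<close>, and under the
  nonunits since these act as zero.\<close>

lemma nonunit_free_factor_generated:
  fixes scale :: "'k::alg_closed_field \<Rightarrow> 'v::ab_group_add \<Rightarrow> 'v"
  assumes mod: "monoid_module M scale act"
    and TA: "virtually_commutative_units M T A"
    and Ws: "composition_series M scale act L H Ws"
    and fin: "H \<subseteq> module.span scale (L \<union> S)" "finite S"
    and i: "Suc i < length Ws"
    and nonunits: "\<And>x. x \<in> carrier M - Units M \<Longrightarrow> act x ` (Ws ! Suc i) \<subseteq> Ws ! i"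
  obtains X where "finite X" "card X \<le> card T" "Ws ! Suc i \<subseteq> module.span scale (Ws ! i \<union> X)"
proof -
  interpret vector_space scale using mod by (simp add: monoid_module_def)
  let ?W = "Ws ! i" and ?U = "Ws ! Suc i"
  have lin: "Vector_Spaces.linear scale scale (act x)" if "x \<in> carrier M" for x
    using mod that by (simp add: monoid_module_def)
  have mult: "act (x \<otimes>\<^bsub>M\<^esub> y) = act x \<circ> act y" if "x \<in> carrier M" "y \<in> carrier M" for x y
    using mod that by (simp add: monoid_module_def)
  have carr: "x \<in> carrier M" if "x \<in> Units M" for x using that by (simp add: Units_def)
  have A: "a \<in> Units M" if "a \<in> A" for a using that TA by (auto simp: virtually_commutative_units_def)
  have T: "t \<in> Units M" if "t \<in> T" for t using that TA by (auto simp: virtually_commutative_units_def)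
  have finT: "finite T" and one: "\<one>\<^bsub>M\<^esub> \<in> Units M" using TA by (auto simp: virtually_commutative_units_def)
  note nth = composition_series_nth[OF Ws]
  have subW: "is_submodule M scale act ?W" and subU: "is_submodule M scale act ?U"
    using nth(4) i by auto
  have WU: "?W \<subset> ?U" using nth(5) i by blast
  have "?U \<subseteq> span (?W \<union> S)"
  proof -
    have "span (L \<union> S) \<subseteq> span (?W \<union> S)"
      using composition_series_between(1)[OF Ws, of i] i by (intro span_mono) auto
    then show ?thesis using composition_series_between(2)[OF Ws i] fin by blast
  qed
  then obtain u where u: "u \<in> ?U" "u \<notin> ?W"
    and eig: "\<And>a. a \<in> act ` A \<Longrightarrow> \<exists>c. a u - scale c u \<in> ?W"
  proof (rule common_eigenvector_modulo[rotated 5, of ?U scale ?W S "act ` A"])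
    fix a b assume "a \<in> act ` A" "b \<in> act ` A"
    then obtain x y where xy: "x \<in> A" "y \<in> A" "a = act x" "b = act y" by blast
    have "x \<otimes>\<^bsub>M\<^esub> y = y \<otimes>\<^bsub>M\<^esub> x" using xy TA by (auto simp: virtually_commutative_units_def)
    then show "a \<circ> b = b \<circ> a" using mult carr A xy by metis
  next
    fix a assume "a \<in> act ` A"
    then obtain x where x: "x \<in> carrier M" "a = act x" using carr A by blast
    then show "a ` ?W \<subseteq> ?W" "a ` ?U \<subseteq> ?U" "Vector_Spaces.linear scale scale a"
      using lin is_submoduleD(2)[OF subW] is_submoduleD(2)[OF subU] by auto
  qed (use WU fin(2) is_submoduleD(1)[OF subW] is_submoduleD(1)[OF subU] vector_space_axioms in auto)
  define X where "X = (\<lambda>t. act t u) ` T"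
  let ?Y = "span (?W \<union> X)"
  have gu: "act g u \<in> ?Y" if g: "g \<in> Units M" for g
  proof -
    obtain t a where ta: "t \<in> T" "a \<in> A" "g = t \<otimes>\<^bsub>M\<^esub> a"
      using g TA by (auto simp: virtually_commutative_units_def)
    interpret t: Vector_Spaces.linear scale scale "act t" by (rule lin[OF carr[OF T[OF ta(1)]]])
    obtain c where c: "act a u - scale c u \<in> ?W" using eig ta by blast
    have "act g u = act t (act a u)" using mult carr T A ta by simp
    also have "\<dots> = act t (act a u - scale c u) + scale c (act t u)" by (simp add: t.diff t.scale)
    also have "\<dots> \<in> ?Y"
    proof (rule span_add)
      show "act t (act a u - scale c u) \<in> ?Y"
        using is_submoduleD(2)[OF subW carr[OF T[OF ta(1)]] c] by (auto intro: span_base)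
      have "act t u \<in> ?Y" using ta(1) by (intro span_base) (simp add: X_def)
      then show "scale c (act t u) \<in> ?Y" by (rule span_scale)
    qed
    finally show ?thesis .
  qed
  have XU: "X \<subseteq> ?U" using is_submoduleD(2)[OF subU] u T carr by (auto simp: X_def)
  have "is_submodule M scale act ?Y"
  proof (rule is_submodule_span_Un[OF vector_space_axioms lin subW])
    fix x assume x: "x \<in> carrier M"
    show "act x ` X \<subseteq> ?Y"
    proof (cases "x \<in> Units M")
      case True
      have "act x (act t u) \<in> ?Y" if "t \<in> T" for t
      proof -
        have "x \<otimes>\<^bsub>M\<^esub> t \<in> Units M" using True T[OF that] TA by (auto simp: virtually_commutative_units_def)
        from gu[OF this] show ?thesis using mult[OF x carr[OF T[OF that]]] by simp
      qed
      then show ?thesis by (auto simp: X_def)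
    next
      case False
      then have "act x ` X \<subseteq> ?W" using nonunits[of x] x XU by blast
      then show ?thesis by (auto intro: span_base)
    qed
  qed
  moreover have "u \<in> ?Y" using gu[OF one] mod by (simp add: monoid_module_def)
  then have "?W \<subset> ?Y" using u by (auto intro: span_base)
  moreover have "?Y \<subseteq> ?U" using WU XU is_submoduleD(1)[OF subU] by (intro span_minimal) auto
  ultimately have "?Y = ?U" using Ws i unfolding composition_series_def by blast
  moreover have "card X \<le> card T" unfolding X_def by (rule card_image_le[OF finT])
  moreover have "finite X" using finT by (simp add: X_def)
  ultimately show ?thesis using that by blast
qed

lemma monoid_module_tensor_act:
  assumes "monoid_module M scale act"
  shows "monoid_module M free_scale (tensor_act act :: _ \<Rightarrow> ('v::ab_group_add list \<Rightarrow>\<^sub>0 'k::field) \<Rightarrow> _)"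
proof -
  have "tensor_act act \<one>\<^bsub>M\<^esub> = (id :: ('v list \<Rightarrow>\<^sub>0 'k) \<Rightarrow> _)"
    by (rule linear_eq_if_eq_on_singles[OF linear_tensor_act free.linear_id])
      (use assms in \<open>simp add: monoid_module_def\<close>)
  then show ?thesis
    using assms by (simp add: monoid_module_def linear_tensor_act tensor_act_comp free.vector_space_axioms)
qed

text \<open>The factors counted by \<open>good\<close> have dimension at most \<open>card T\<close>. The others are covered by the
  degenerate tensors, which have dimension at most \<open>q n\<close> modulo the relations.\<close>

lemma tensor_series_counts:
  fixes scale :: "'k::alg_closed_field \<Rightarrow> 'v::ab_group_add \<Rightarrow> 'v"
  assumes mod: "monoid_module M scale act"
    and "finite_dimensional_vector_space scale B"
    and nonunits: "\<And>x. x \<in> carrier M - Units M \<Longrightarrow> \<not> bij (act x)"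
    and TA: "virtually_commutative_units M T A"
  defines "d \<equiv> card B"
  defines "Ws \<equiv> tensor_series M scale act"
  defines "good \<equiv> \<lambda>n. card {i. Suc i < length (Ws n) \<and>
                     (\<forall>x\<in>carrier M - Units M. tensor_act act x ` (Ws n ! Suc i) \<subseteq> Ws n ! i)}"
  defines "q \<equiv> \<lambda>n. d * (d - 1) ^ n * (n + 1) ^ d"
  shows "tensor_length M scale act n \<le> d ^ n"
    and "good n \<le> tensor_length M scale act n"
    and "tensor_length M scale act n \<le> good n + q n"
    and "d ^ n \<le> q n + card T * good n"
    and "0 < d ^ n \<Longrightarrow> 0 < tensor_length M scale act n"
proof -
  interpret finite_dimensional_vector_space scale B by fact
  let ?L = "tensor_rel scale n" and ?H = "tensor_free n :: ('v list \<Rightarrow>\<^sub>0 'k) set"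
  let ?J = "degenerate_tensors n" and ?act = "tensor_act act :: _ \<Rightarrow> ('v list \<Rightarrow>\<^sub>0 'k) \<Rightarrow> _"
  note tmod = monoid_module_tensor_act[OF mod]
  have lin: "Vector_Spaces.linear scale scale (act x)" if "x \<in> carrier M" for x
    using mod that by (simp add: monoid_module_def)
  note tlin = linear_tensor_act[where act = act]
  have sub: "is_submodule M free_scale ?act ?L" "is_submodule M free_scale ?act ?H"
      "is_submodule M free_scale ?act ?J"
    using tensor_act_tensor_rel[where act = act] lin tensor_act_tensor_free[where act = act]
      tensor_act_degenerate[where act = act]
    by (simp_all add: is_submodule_def subspace_tensor_rel subspace_tensor_free degenerate_tensors_def)
  obtain S where S: "finite S" "?J \<subseteq> free.span (?L \<union> S)" "card S \<le> q n"
    using degenerate_tensors_bound[of n] unfolding q_def d_def by blast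
  have "\<exists>Ws. composition_series M free_scale ?act ?L ?H Ws"
    by (rule composition_series_exists[OF free.vector_space_axioms finite_basis_tensors sub(1,2)
          tensor_rel_subset_tensor_free tensor_free_subset_span])
  then have Ws: "composition_series M free_scale ?act ?L ?H (Ws n)"
    unfolding Ws_def tensor_series_def by (rule someI_ex)
  note nth = composition_series_nth[OF Ws]
  let ?l = "tensor_length M scale act n"
  have l: "?l = length (Ws n) - 1" by (simp add: tensor_length_def Ws_def)
  show "?l \<le> d ^ n"
    unfolding l d_def
    using composition_series_length_le[OF free.vector_space_axioms Ws tensor_free_subset_span] card_basis_tensors
    by simp
  define G where "G = {i. Suc i < length (Ws n) \<and>
                     (\<forall>x\<in>carrier M - Units M. ?act x ` (Ws n ! Suc i) \<subseteq> Ws n ! i)}"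
  have good: "good n = card G" by (simp add: good_def G_def)
  have G: "G \<subseteq> {..<?l}" by (auto simp: G_def l)
  show "good n \<le> ?l" unfolding good using card_mono[OF _ G] by simp
  \<comment> \<open>a nonunit that is nonzero on the factor yields a degenerate tensor in the upper term only\<close>
  have bad: "\<not> ?J \<inter> Ws n ! Suc i \<subseteq> Ws n ! i" if "i < ?l" "i \<notin> G" for i
  proof -
    have i: "Suc i < length (Ws n)" using that l by simp
    then obtain x p where x: "x \<in> carrier M - Units M" and p: "p \<in> Ws n ! Suc i" "?act x p \<notin> Ws n ! i"
      using \<open>i \<notin> G\<close> unfolding G_def by blast
    have "p \<in> ?H" using composition_series_between(2)[OF Ws i] p by blast
    then have "?act x p \<in> ?J"
      using tensor_act_noninvertible[where act = act and x = x and n = n] lin nonunits x by blast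
    moreover have "?act x p \<in> Ws n ! Suc i"
      using is_submoduleD(2)[OF nth(4)[OF i]] x p by blast
    ultimately show ?thesis using p by blast
  qed
  have "card ({..<?l} - G) \<le> card {i. Suc i < length (Ws n) \<and> \<not> ?J \<inter> Ws n ! Suc i \<subseteq> Ws n ! i}"
  proof (rule card_mono)
    show "finite {i. Suc i < length (Ws n) \<and> \<not> ?J \<inter> Ws n ! Suc i \<subseteq> Ws n ! i}"
      by (rule finite_subset[of _ "{..<length (Ws n)}"]) auto
  qed (use bad l in auto)
  also have "\<dots> \<le> card S"
  proof (rule card_strict_steps_Int[OF free.vector_space_axioms Ws _ _ S(2,1)])
    show "free.subspace ?J" by (simp add: degenerate_tensors_def)
    show "?L \<subseteq> ?J" by (auto simp: degenerate_tensors_def intro: free.span_base)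
  qed
  finally have "card ({..<?l} - G) \<le> q n" using S by simp
  moreover have "card ({..<?l} - G) = ?l - card G"
    using G by (simp add: card_Diff_subset finite_subset)
  ultimately show "?l \<le> good n + q n" using good by simp
  have "\<exists>X. finite X \<and> card X \<le> card T \<and> Ws n ! Suc i \<subseteq> free.span (Ws n ! i \<union> X)" if "i \<in> G" for i
  proof -
    have i: "Suc i < length (Ws n)"
        "\<And>x. x \<in> carrier M - Units M \<Longrightarrow> ?act x ` (Ws n ! Suc i) \<subseteq> Ws n ! i"
      using that unfolding G_def by blast+
    obtain X where "finite X" "card X \<le> card T" "Ws n ! Suc i \<subseteq> free.span (Ws n ! i \<union> X)"
      by (rule nonunit_free_factor_generated[OF tmod TA Ws tensor_free_subset_span finite_basis_tensors i])
    then show ?thesis by blast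
  qed
  then obtain X where X: "\<And>i. i \<in> G \<Longrightarrow> finite (X i)" "\<And>i. i \<in> G \<Longrightarrow> card (X i) \<le> card T"
      "\<And>i. i \<in> G \<Longrightarrow> Ws n ! Suc i \<subseteq> free.span (Ws n ! i \<union> X i)"
    by metis
  \<comment> \<open>what each term of the series needs beyond the preceding one: the few generators of a good
    factor, or \<open>J\<close> for any other\<close>
  define Y where "Y i = (if i \<in> G then X i else ?J)" for i
  have "Ws n ! ?l \<subseteq> free.span (Ws n ! 0 \<union> (\<Union>i<?l. Y i))"
  proof (rule free.chain_subset_span)
    fix i assume i: "i < ?l"
    show "Ws n ! Suc i \<subseteq> free.span (Ws n ! i \<union> Y i)"
    proof (cases "i \<in> G")
      case True
      then show ?thesis using X by (simp add: Y_def)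
    next
      case False
      then show ?thesis
        using composition_factor_covered[OF free.vector_space_axioms Ws tlin sub(3) _ bad[OF i False]] i l
        by (simp add: Y_def)
    qed
  qed
  also have "\<dots> \<subseteq> free.span (?L \<union> (S \<union> (\<Union>i\<in>G. X i)))" (is "_ \<subseteq> ?Z")
  proof (rule free.span_minimal[OF _ free.subspace_span])
    have "?J \<subseteq> ?Z" by (rule order_trans[OF S(2)], rule free.span_mono) auto
    then have "Y i \<subseteq> ?Z" for i by (auto simp: Y_def intro: free.span_base)
    then show "Ws n ! 0 \<union> (\<Union>i<?l. Y i) \<subseteq> ?Z" using nth(1) by (auto intro: free.span_base)
  qed
  finally have "?H \<subseteq> ?Z" using nth(2) l by simp
  moreover have finG: "finite G" using G finite_subset by blast
  ultimately have "card B ^ n \<le> card (S \<union> (\<Union>i\<in>G. X i))"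
    using card_Basis_power_le S X by simp
  also have "\<dots> \<le> card S + card (\<Union>i\<in>G. X i)" by (rule card_Un_le)
  also have "\<dots> \<le> q n + card T * card G"
  proof (rule add_mono[OF S(3)])
    have "card (\<Union>i\<in>G. X i) \<le> (\<Sum>i\<in>G. card (X i))" by (rule card_UN_le[OF finG])
    also have "\<dots> \<le> (\<Sum>i\<in>G. card T)" by (rule sum_mono) (use X in auto)
    finally show "card (\<Union>i\<in>G. X i) \<le> card T * card G" by (simp add: mult.commute)
  qed
  finally show "d ^ n \<le> q n + card T * good n" by (simp add: good d_def)
  assume "0 < d ^ n"
  show "0 < ?l"
  proof (rule ccontr)
    assume "\<not> 0 < ?l"
    then have "?H = ?L" using nth(1,2) l by simp
    then have "?H \<subseteq> free.span (?L \<union> {})" by (auto intro: free.span_base)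
    from card_Basis_power_le[OF this] show False using \<open>0 < d ^ n\<close> by (simp add: d_def)
  qed
qed

section \<open>The asymptotics of the counts\<close>

text \<open>With \<open>y\<close> the \<open>d\<close>-th root of \<open>(d - 1) / d\<close>, the quotient is
  \<open>d ((n + 1) y^n)^d\<close>.\<close>

lemma exponential_beats_polynomial:
  fixes d :: nat
  assumes "d > 0"
  shows "(\<lambda>n. real (d * (d - 1) ^ n * (n + 1) ^ d) / real (d ^ n)) \<longlonglongrightarrow> 0"
proof (cases "d = 1")
  case True
  \<comment> \<open>the factor \<open>(d - 1) ^ n\<close> vanishes except for \<open>n = 0\<close>, where \<open>0 ^ 0 = 1\<close>\<close>
  have "(\<lambda>n. real (d * (d - 1) ^ Suc n * (Suc n + 1) ^ d) / real (d ^ Suc n)) \<longlonglongrightarrow> 0"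
    by (simp add: True)
  then show ?thesis by (rule LIMSEQ_imp_Suc)
next
  case False
  define x where "x = real (d - 1) / real d"
  have x: "0 < x" "x < 1" using assms False by (auto simp: x_def)
  define y where "y = root d x"
  have y: "0 < y" "y < 1" "y ^ d = x"
    using x assms by (auto simp: y_def)
  have "(\<lambda>n. real n * y ^ n) \<longlonglongrightarrow> 0"
    using powser_times_n_limit_0[of y] y by simp
  moreover have "(\<lambda>n. y ^ n) \<longlonglongrightarrow> 0" using y by (intro LIMSEQ_realpow_zero) auto
  ultimately have "(\<lambda>n. real n * y ^ n + y ^ n) \<longlonglongrightarrow> 0 + 0" by (rule tendsto_add)
  then have "(\<lambda>n. real d * (real n * y ^ n + y ^ n) ^ d) \<longlonglongrightarrow> real d * (0 + 0) ^ d"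
    by (intro tendsto_mult tendsto_power tendsto_const)
  moreover have "real d * (real n * y ^ n + y ^ n) ^ d = real (d * (d - 1) ^ n * (n + 1) ^ d) / real (d ^ n)" for n
  proof -
    have "(real n * y ^ n + y ^ n) ^ d = ((real n + 1) * y ^ n) ^ d" by (simp add: algebra_simps)
    also have "\<dots> = (real n + 1) ^ d * x ^ n"
      by (simp add: power_mult_distrib y(3)[symmetric] power_mult[symmetric] mult.commute)
    finally show ?thesis by (simp add: x_def power_divide add.commute)
  qed
  ultimately show ?thesis using assms by (simp add: power_0_left)
qed

text \<open>From some \<open>N\<close> on, \<open>q n\<close> is at most half of \<open>d^n\<close>, so the good factors have to account for the
  other half; below \<open>N\<close> it suffices that \<open>l n\<close> is at least \<open>1\<close>.\<close>

lemma growth_from_counts: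
  fixes l good q :: "nat \<Rightarrow> nat" and d b :: nat
  assumes d: "d > 0" and q: "(\<lambda>n. real (q n) / real (d ^ n)) \<longlonglongrightarrow> 0"
    and lower: "\<And>n. d ^ n \<le> q n + b * good n"
    and good: "\<And>n. good n \<le> l n" "\<And>n. l n \<le> good n + q n" and pos: "\<And>n. 0 < l n"
  shows "\<exists>C::real. C > 0 \<and> (\<forall>n. C * real d ^ n \<le> real (l n))"
    and "(\<lambda>n. real (good n) / real (l n)) \<longlonglongrightarrow> 1"
proof -
  have "\<forall>\<^sub>F n in sequentially. real (q n) / real (d ^ n) < 1 / 2"
    using order_tendstoD(2)[OF q, of "1/2"] by simp
  then obtain N where N: "\<And>n. n \<ge> N \<Longrightarrow> real (q n) / real (d ^ n) < 1 / 2"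
    by (auto simp: eventually_sequentially)
  \<comment> \<open>the first bound serves from \<open>N\<close> on, the second one below \<open>N\<close>\<close>
  define C where "C = min (1 / (2 * real (b + 1))) (1 / real d ^ N)"
  have C: "C > 0" using d by (simp add: C_def)
  have le: "C * real d ^ n \<le> real (l n)" for n
  proof (cases "n \<ge> N")
    case True
    have "real (d ^ n) \<le> real (q n) + real b * real (good n)"
      using lower[of n] by (metis of_nat_add of_nat_le_iff of_nat_mult)
    moreover have "real (q n) \<le> real (d ^ n) / 2" using N[OF True] d by (simp add: field_simps)
    moreover have "real b * real (good n) \<le> real (b + 1) * real (l n)"
      using good(1)[of n] by (intro mult_mono) auto
    moreover have "real (d ^ n) = real d ^ n" by simp
    ultimately have "real d ^ n \<le> 2 * (real (b + 1) * real (l n))" by linarith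
    then have "1 / (2 * real (b + 1)) * real d ^ n \<le> real (l n)" by (simp add: field_simps)
    moreover have "C * real d ^ n \<le> 1 / (2 * real (b + 1)) * real d ^ n"
      by (rule mult_right_mono) (auto simp: C_def)
    ultimately show ?thesis by linarith
  next
    case False
    have "C * real d ^ n \<le> 1 / real d ^ N * real d ^ N"
      using False d C by (intro mult_mono power_increasing) (auto simp: C_def)
    also have "\<dots> \<le> real (l n)" using pos[of n] d by simp
    finally show ?thesis .
  qed
  then show "\<exists>C::real. C > 0 \<and> (\<forall>n. C * real d ^ n \<le> real (l n))" using C by blast
  have "(\<lambda>n. 1 - (1 / C) * (real (q n) / real (d ^ n))) \<longlonglongrightarrow> 1 - (1 / C) * 0"
    by (intro tendsto_intros q)
  then have lim: "(\<lambda>n. 1 - (1 / C) * (real (q n) / real (d ^ n))) \<longlonglongrightarrow> 1" by simp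
  show "(\<lambda>n. real (good n) / real (l n)) \<longlonglongrightarrow> 1"
  proof (rule tendsto_sandwich[OF _ _ lim tendsto_const])
    show "\<forall>\<^sub>F n in sequentially. real (good n) / real (l n) \<le> 1"
      using good(1) pos by (intro always_eventually allI) (simp add: divide_le_eq)
    show "\<forall>\<^sub>F n in sequentially. 1 - (1 / C) * (real (q n) / real (d ^ n)) \<le> real (good n) / real (l n)"
    proof (intro always_eventually allI)
      fix n
      have "real (q n) / real (l n) \<le> real (q n) / (C * real d ^ n)"
        using le[of n] C d by (intro divide_left_mono) (auto simp: pos)
      moreover have "real (l n) \<le> real (good n) + real (q n)" using good(2)[of n] by linarith
      then have "1 \<le> real (good n) / real (l n) + real (q n) / real (l n)"
        using pos[of n] by (simp add: field_simps)
      ultimately show "1 - (1 / C) * (real (q n) / real (d ^ n)) \<le> real (good n) / real (l n)" by simp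
    qed
  qed
qed

section \<open>Units of the diagram monoids\<close>

text \<open>A vertex is labelled with the bottom end of its strand when the strands join top \<open>i\<close> to bottom
  \<open>f i\<close>. For a bijection \<open>f\<close>, components are then exactly the fibres of the label.\<close>

primrec strand_label :: "(int \<Rightarrow> int) \<Rightarrow> vertex \<Rightarrow> int" where
  "strand_label f (Top i) = f i"
| "strand_label f (Bot j) = j"

definition strands :: "(int \<Rightarrow> int) \<Rightarrow> diagram" where
  "strands f = Diagram {(u, v). strand_label f u = strand_label f v} 0"

lemma conn_strands [simp]: "(u, v) \<in> conn (strands f) \<longleftrightarrow> strand_label f u = strand_label f v"
  and loops_strands [simp]: "loops (strands f) = 0"
  by (simp_all add: strands_def)

lemma strands_inject: "strands f = strands g \<Longrightarrow> f = g"
proof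
  fix i assume eq: "strands f = strands g"
  have "(Top i, Bot (f i)) \<in> conn (strands f)" by simp
  then have "(Top i, Bot (f i)) \<in> conn (strands g)" by (simp only: eq)
  then show "f i = g i" by simp
qed

lemma id_diagram_eq_strands: "id_diagram m = strands id"
proof -
  let ?T = "{(Top j, Bot j) | j. True}"
  have "{(shift (t * int m) u, shift (t * int m) v) | t u v. (u, v) \<in> vertical m {}} = ?T"
  proof (intro equalityI subsetI)
    fix x assume "x \<in> ?T"
    then obtain j where "x = (Top j, Bot j)" by blast
    then have "x = (shift (0 * int m) (Top j), shift (0 * int m) (Bot j)) \<and> (Top j, Bot j) \<in> vertical m {}"
      by (simp add: vertical_def)
    then show "x \<in> {(shift (t * int m) u, shift (t * int m) v) | t u v. (u, v) \<in> vertical m {}}"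
      by blast
  qed (auto simp: vertical_def)
  moreover have "(?T \<union> ?T\<inverse>)\<^sup>* = {(u, v). strand_label id u = strand_label id v}"
  proof (intro equalityI subrelI)
    fix u v assume "(u, v) \<in> (?T \<union> ?T\<inverse>)\<^sup>*"
    then show "(u, v) \<in> {(u, v). strand_label id u = strand_label id v}"
      by (induction rule: rtrancl_induct) auto
  next
    fix u v assume "(u, v) \<in> {(u, v). strand_label id u = strand_label id v}"
    then show "(u, v) \<in> (?T \<union> ?T\<inverse>)\<^sup>*"
      by (cases u; cases v) (auto intro: r_into_rtrancl)
  qed
  ultimately show ?thesis
    by (simp add: id_diagram_def from_edges_def strands_def Let_def)
qed

lemma equiv_stack_conn:
  assumes "sym (conn D)" "sym (conn E)"
  shows "equiv UNIV (stack_conn D E)"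
proof -
  have "sym (map_prod upper_part upper_part ` conn D \<union> map_prod lower_part lower_part ` conn E)"
    using assms by (auto simp: sym_def)
  then show ?thesis
    unfolding stack_conn_def by (intro equivI refl_rtrancl sym_rtrancl trans_rtrancl) auto
qed

lemma stack_conn_upper: "(u, v) \<in> conn D \<Longrightarrow> (upper_part u, upper_part v) \<in> stack_conn D E"
  unfolding stack_conn_def by (intro r_into_rtrancl UnI1) force

lemma stack_conn_lower: "(u, v) \<in> conn E \<Longrightarrow> (lower_part u, lower_part v) \<in> stack_conn D E"
  unfolding stack_conn_def by (intro r_into_rtrancl UnI2) force

text \<open>Following strands downwards labels the vertices of the stack with the bottom vertex that they
  reach; every component contains its bottom vertex, so no loop arises.\<close>

lemma compose_strands: "compose (strands f) (strands g) = strands (g \<circ> f)"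
proof -
  define label where "label x = (case x of Upper i \<Rightarrow> g (f i) | Middle j \<Rightarrow> g j | Lower k \<Rightarrow> k)" for x
  have eq: "equiv UNIV (stack_conn (strands f) (strands g))"
    by (rule equiv_stack_conn) (auto simp: sym_def)
  have label: "label (upper_part u) = g (strand_label f u)" "label (lower_part u) = strand_label g u" for u
    by (cases u; simp add: label_def)+
  have sound: "label x = label y" if "(x, y) \<in> stack_conn (strands f) (strands g)" for x y
    using that unfolding stack_conn_def by (induction rule: rtrancl_induct) (auto simp: label)
  have mid: "(Middle j, Lower (g j)) \<in> stack_conn (strands f) (strands g)" for j
    using stack_conn_lower[of "Top j" "Bot (g j)" "strands g" "strands f"] by simp
  have "(Upper i, Middle (f i)) \<in> stack_conn (strands f) (strands g)" for i
    using stack_conn_upper[of "Top i" "Bot (f i)" "strands f" "strands g"] by simp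
  then have low: "(x, Lower (label x)) \<in> stack_conn (strands f) (strands g)" for x
    using mid equivE[OF eq] by (cases x) (auto simp: label_def refl_on_def elim: transE)
  have conn: "(x, y) \<in> stack_conn (strands f) (strands g) \<longleftrightarrow> label x = label y" for x y
    using sound low[of x] low[of y] eq by (metis equiv_def symE transE)
  have outer: "label (outer u) = strand_label (g \<circ> f) u" for u by (cases u) (auto simp: label_def)
  have "{K \<in> UNIV // stack_conn (strands f) (strands g). K \<subseteq> range Middle \<and> infinite K} = {}"
  proof -
    have "\<not> K \<subseteq> range Middle" if K: "K \<in> UNIV // stack_conn (strands f) (strands g)" for K
    proof -
      obtain x where "K = stack_conn (strands f) (strands g) `` {x}" using K by (auto simp: quotient_def)
      then have "Lower (label x) \<in> K" using low by auto
      then show ?thesis by auto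
    qed
    then show ?thesis by blast
  qed
  then have "new_loops (strands f) (strands g) = 0"
    unfolding new_loops_def by (simp only: card.empty)
  then show ?thesis
    by (simp add: compose_def conn outer) (simp add: strands_def)
qed

text \<open>An edge between two top vertices of \<open>D\<close> survives in \<open>D E\<close>, and one between two bottom vertices
  in \<open>E D\<close>; the identity has neither. A top vertex that \<open>D\<close> does not join to the bottom would be
  isolated in \<open>D E\<close>, and dually for bottom vertices in \<open>E D\<close>. So each component of \<open>D\<close> is a
  strand from top to bottom.\<close>

lemma invertible_is_strands:
  assumes D: "equiv UNIV (conn D)" and E: "equiv UNIV (conn E)"
    and DE: "conn (compose D E) = conn (strands id)" and ED: "conn (compose E D) = conn (strands id)"
  obtains f where "bij f" "conn D = conn (strands f)"
proof -
  have DE': "(outer u, outer v) \<in> stack_conn D E \<longleftrightarrow> strand_label id u = strand_label id v" for u v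
    using DE by (auto simp: compose_def set_eq_iff strands_def)
  have ED': "(outer u, outer v) \<in> stack_conn E D \<longleftrightarrow> strand_label id u = strand_label id v" for u v
    using ED by (auto simp: compose_def set_eq_iff strands_def)
  have tr: "(u, w) \<in> conn D" if "(u, v) \<in> conn D" "(v, w) \<in> conn D" for u v w
    using D that by (meson equiv_def transE)
  have sy: "(v, u) \<in> conn D" if "(u, v) \<in> conn D" for u v
    using D that by (meson equiv_def symE)
  have re: "(u, u) \<in> conn D" for u
    using D by (auto simp: equiv_def refl_on_def)
  have top_inj: "i = j" if "(Top i, Top j) \<in> conn D" for i j
    using stack_conn_upper[OF that, of E] DE'[of "Top i" "Top j"] by simp
  have bot_inj: "i = j" if "(Bot i, Bot j) \<in> conn D" for i j
    using stack_conn_lower[OF that, of E] ED'[of "Bot i" "Bot j"] by simp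
  have "\<exists>j. (Top i, Bot j) \<in> conn D" for i
  proof (rule ccontr)
    assume no: "\<not> ?thesis"
    have "x = Upper i" if "(Upper i, x) \<in> stack_conn D E" for x
      using that unfolding stack_conn_def
    proof (induction rule: rtrancl_induct)
      case (step y z)
      then consider u v where "(u, v) \<in> conn D" "y = upper_part u" "z = upper_part v"
        | u where "y = lower_part u" by auto
      then show ?case
      proof cases
        case 1
        then have "u = Top i" using step by (cases u) auto
        then show ?thesis using 1 no top_inj by (cases v) auto
      next
        case 2
        then show ?thesis using step by (cases u) auto
      qed
    qed simp
    then show False using DE'[of "Top i" "Bot i"] by auto
  qed
  then obtain f where f: "\<And>i. (Top i, Bot (f i)) \<in> conn D" by metis
  have "\<exists>i. (Top i, Bot j) \<in> conn D" for j
  proof (rule ccontr)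
    assume no: "\<not> ?thesis"
    have "x = Lower j" if "(Lower j, x) \<in> stack_conn E D" for x
      using that unfolding stack_conn_def
    proof (induction rule: rtrancl_induct)
      case (step y z)
      then consider u v where "(u, v) \<in> conn D" "y = lower_part u" "z = lower_part v"
        | u where "y = upper_part u" by auto
      then show ?case
      proof cases
        case 1
        then have "u = Bot j" using step by (cases u) auto
        then show ?thesis using 1 no bot_inj by (cases v) (auto dest: sy)
      next
        case 2
        then show ?thesis using step by (cases u) auto
      qed
    qed simp
    then show False using ED'[of "Bot j" "Top j"] by auto
  qed
  then obtain g where g: "\<And>j. (Top (g j), Bot j) \<in> conn D" by metis
  have fg: "f (g j) = j" for j
    using tr[OF sy[OF f[of "g j"]] g[of j]] bot_inj by blast
  have gf: "g (f i) = i" for i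
    using tr[OF g[of "f i"] sy[OF f[of i]]] top_inj by blast
  have "bij f" by (rule o_bij[of g]) (auto simp: fun_eq_iff fg gf)
  have bot: "(u, Bot (strand_label f u)) \<in> conn D" for u
    using f re by (cases u) auto
  have "(u, v) \<in> conn D \<longleftrightarrow> strand_label f u = strand_label f v" for u v
    using bot[of u] bot[of v] tr sy bot_inj by metis
  then have "conn D = conn (strands f)" by (auto simp: strands_def)
  then show ?thesis using that \<open>bij f\<close> by blast
qed

lemma affine_diagram_strands:
  "affine_diagram m (strands f) \<longleftrightarrow> (\<forall>i. f (i + int m) = f i + int m)"
proof
  assume a: "affine_diagram m (strands f)"
  show "\<forall>i. f (i + int m) = f i + int m"
  proof
    fix i
    have "(Top i, Bot (f i)) \<in> conn (strands f)" by simp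
    then have "(shift (int m) (Top i), shift (int m) (Bot (f i))) \<in> conn (strands f)"
      using a unfolding affine_diagram_def by blast
    then show "f (i + int m) = f i + int m" by simp
  qed
next
  assume f: "\<forall>i. f (i + int m) = f i + int m"
  have "strand_label f (shift (int m) u) = strand_label f u + int m" for u
    using f by (cases u) auto
  then show "affine_diagram m (strands f)"
    by (auto simp: affine_diagram_def equiv_def refl_on_def sym_def trans_def)
qed

text \<open>Two strands cross exactly if \<open>f\<close> reverses the order of their ends.\<close>

lemma planar_strands:
  assumes "bij f"
  shows "planar (strands f) \<longleftrightarrow> strict_mono f"
proof
  assume p: "planar (strands f)"
  show "strict_mono f"
  proof (rule strict_monoI, rule ccontr)
    fix i j assume ij: "i < j" "\<not> f i < f j"
    then have "f j \<noteq> f i" using assms by (auto simp: bij_def inj_eq)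
    then have "f j < f i" using ij by simp
    then have "(Bot (f j), Bot (f i)) \<in> conn (strands f)"
      using p[unfolded planar_def, THEN conjunct1, rule_format,
          of "Bot (f j)" "Bot (f i)" "Top j" "Top i"] ij by simp
    then show False using \<open>f j < f i\<close> by simp
  qed
next
  assume f: "strict_mono f"
  have "strand_label f a = strand_label f b"
    if "boundary_less a b" "boundary_less b c" "boundary_less c d"
      "strand_label f a = strand_label f c" "strand_label f b = strand_label f d" for a b c d
    using that strict_mono_less[OF f] strict_mono_eq[OF f]
    by (cases a; cases b; cases c; cases d) auto
  then show "planar (strands f)" by (auto simp: planar_def)
qed

text \<open>The condition on \<open>f\<close> is preserved by composition, which is why products of units stay in the
  monoid.\<close>

lemma strands_in_affine_diagrams:
  assumes "bij f"
  shows "strands f \<in> affine_diagrams fam m \<longleftrightarrow>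
    (\<forall>i. f (i + int m) = f i + int m) \<and> (fam \<noteq> Rook \<longrightarrow> strict_mono f)"
proof -
  have component: "\<exists>i. K = {Top i, Bot (f i)}" if K: "K \<in> components (strands f)" for K
  proof -
    obtain u where u: "K = conn (strands f) `` {u}" using K by (auto simp: quotient_def)
    obtain i where i: "strand_label f u = f i" using assms by (metis bij_pointE)
    have "v \<in> K \<longleftrightarrow> v = Top i \<or> v = Bot (f i)" for v
      using u i assms by (cases v) (auto simp: bij_def inj_eq)
    then show ?thesis by blast
  qed
  have card: "finite K \<and> card K = 2" if "K \<in> components (strands f)" for K
    using component[OF that] by auto
  have rook: "rook_diagram (strands f)"
    unfolding rook_diagram_def using component by fastforce
  show ?thesis
    by (cases fam) (auto simp: affine_diagram_strands planar_strands[OF assms] rook card)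
qed

lemma equiv_conn_affine: "affine_diagram m D \<Longrightarrow> equiv UNIV (conn D)"
  by (simp add: affine_diagram_def)

lemma shift_invariantI:
  assumes "\<And>u v. (u, v) \<in> R \<Longrightarrow> (shift t u, shift t v) \<in> R"
    and "\<And>u v. (u, v) \<in> R \<Longrightarrow> (shift (- t) u, shift (- t) v) \<in> R"
  shows "(u, v) \<in> R \<longleftrightarrow> (shift t u, shift t v) \<in> R"
proof -
  have "shift (- t) (shift t w) = w" for w by (cases w) auto
  then show ?thesis using assms(1)[of u v] assms(2)[of "shift t u" "shift t v"] by auto
qed

lemma loops_from_edges [simp]: "loops (from_edges m X) = 0"
  by (simp add: from_edges_def Let_def)

lemma affine_diagram_from_edges: "affine_diagram m (from_edges m X)"
proof -
  define T where "T = {(shift (t * int m) u, shift (t * int m) v) | t u v. (u, v) \<in> X}"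
  let ?R = "(T \<union> T\<inverse>)\<^sup>*"
  have shift_shift: "shift s (shift t w) = shift (t + s) w" for s t w by (cases w) auto
  have T: "(shift (k * int m) u, shift (k * int m) v) \<in> T" if uv: "(u, v) \<in> T" for u v k
  proof -
    obtain t a b where "(a, b) \<in> X" "u = shift (t * int m) a" "v = shift (t * int m) b"
      using uv by (auto simp: T_def)
    then have "shift (k * int m) u = shift ((t + k) * int m) a \<and> shift (k * int m) v = shift ((t + k) * int m) b \<and> (a, b) \<in> X"
      by (simp add: shift_shift algebra_simps)
    then show ?thesis unfolding T_def by blast
  qed
  have R: "(shift (k * int m) u, shift (k * int m) v) \<in> ?R" if "(u, v) \<in> ?R" for u v k
    using that
  proof (induction rule: rtrancl_induct)
    case (step y z)
    then have "(shift (k * int m) y, shift (k * int m) z) \<in> T \<union> T\<inverse>" using T by auto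
    then show ?case using step.IH by (rule rtrancl_into_rtrancl[rotated])
  qed simp
  have "equiv UNIV ?R"
    by (intro equivI refl_rtrancl sym_rtrancl trans_rtrancl) (auto simp: sym_def)
  moreover have "(u, v) \<in> ?R \<longleftrightarrow> (shift (int m) u, shift (int m) v) \<in> ?R" for u v
    by (rule shift_invariantI) (use R[of _ _ 1] R[of _ _ "- 1"] in auto)
  moreover have "conn (from_edges m X) = ?R"
    by (simp add: from_edges_def T_def Let_def)
  ultimately show ?thesis by (simp add: affine_diagram_def)
qed

lemma affine_diagram_compose:
  assumes D: "affine_diagram m D" and E: "affine_diagram m E"
  shows "affine_diagram m (compose D E)"
proof -
  let ?S = "stack_conn D E"
  define sh where "sh t x = (case x of Upper i \<Rightarrow> Upper (i + t) | Middle i \<Rightarrow> Middle (i + t) | Lower i \<Rightarrow> Lower (i + t))" for t x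
  have sh: "upper_part (shift t u) = sh t (upper_part u)" "lower_part (shift t u) = sh t (lower_part u)"
      "outer (shift t u) = sh t (outer u)" for t u
    by (cases u; simp add: sh_def)+
  have inv: "shift t (shift (- t) w) = w" for t w by (cases w) auto
  have Dm: "(shift t u, shift t v) \<in> conn D" if "(u, v) \<in> conn D" "t = int m \<or> t = - int m" for u v t
    using that D unfolding affine_diagram_def by (metis inv)
  have Em: "(shift t u, shift t v) \<in> conn E" if "(u, v) \<in> conn E" "t = int m \<or> t = - int m" for u v t
    using that E unfolding affine_diagram_def by (metis inv)
  have S: "(sh t x, sh t y) \<in> ?S" if "(x, y) \<in> ?S" and t: "t = int m \<or> t = - int m" for x y t
    using that(1) unfolding stack_conn_def
  proof (induction rule: rtrancl_induct)
    case (step y z)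
    from step.hyps(2) have "(sh t y, sh t z) \<in>
      map_prod upper_part upper_part ` conn D \<union> map_prod lower_part lower_part ` conn E"
    proof
      assume "(y, z) \<in> map_prod upper_part upper_part ` conn D"
      then obtain u v where "(u, v) \<in> conn D" "y = upper_part u" "z = upper_part v" by auto
      then have "(sh t y, sh t z) = map_prod upper_part upper_part (shift t u, shift t v)" by (simp add: sh)
      then show ?thesis using Dm[OF \<open>(u, v) \<in> conn D\<close> t] by blast
    next
      assume "(y, z) \<in> map_prod lower_part lower_part ` conn E"
      then obtain u v where "(u, v) \<in> conn E" "y = lower_part u" "z = lower_part v" by auto
      then have "(sh t y, sh t z) = map_prod lower_part lower_part (shift t u, shift t v)" by (simp add: sh)
      then show ?thesis using Em[OF \<open>(u, v) \<in> conn E\<close> t] by blast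
    qed
    then show ?case using step.IH by (rule rtrancl_into_rtrancl[rotated])
  qed simp
  have "equiv UNIV ?S"
    using D E by (intro equiv_stack_conn) (auto simp: affine_diagram_def equiv_def)
  moreover have "conn (compose D E) = inv_image ?S outer"
    by (auto simp: compose_def inv_image_def)
  ultimately have "equiv UNIV (conn (compose D E))"
    by (auto simp: equiv_def refl_on_def intro: sym_inv_image trans_inv_image)
  moreover have "(u, v) \<in> conn (compose D E) \<longleftrightarrow> (shift (int m) u, shift (int m) v) \<in> conn (compose D E)" for u v
    by (rule shift_invariantI) (auto simp: compose_def sh intro: S)
  ultimately show ?thesis by (simp add: affine_diagram_def)
qed

lemma affine_diagram_reduce [simp]: "affine_diagram m (reduce D) \<longleftrightarrow> affine_diagram m D"
  by (simp add: affine_diagram_def reduce_def)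

lemma affine_diagrams_affine: "D \<in> affine_diagrams fam m \<Longrightarrow> affine_diagram m D"
  by (cases fam) auto

lemma generators_affine:
  assumes "D \<in> generators fam m"
  shows "affine_diagram m D \<and> loops D = 0"
  using assms by (cases fam)
    (auto simp: gen_e_def gen_l_def gen_r_def gen_s_def gen_p1_def affine_diagram_from_edges)

lemma diagram_monoid_simps:
  "\<one>\<^bsub>diagram_monoid var fam m\<^esub> = id_diagram m"
  "conn (D \<otimes>\<^bsub>diagram_monoid var fam m\<^esub> E) = conn (compose D E)"
  "strands f \<otimes>\<^bsub>diagram_monoid var fam m\<^esub> strands g = strands (g \<circ> f)"
  by (cases var; simp add: affine_monoid_def reduced_affine_monoid_def reduce_def compose_strands;
      simp add: strands_def)+

lemma carrier_diagram_monoid_affine: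
  assumes "D \<in> carrier (diagram_monoid var fam m)"
  shows "affine_diagram m D"
proof -
  have id: "affine_diagram m (id_diagram m)" by (simp add: id_diagram_def affine_diagram_from_edges)
  have per: "affine_diagram m D" if "D \<in> generated_submonoid (affine_monoid fam m) (generators fam m)" for D
    using that by (induction rule: generated_submonoid.induct)
      (simp_all add: affine_monoid_def id generators_affine affine_diagram_compose)
  have red: "affine_diagram m D" if "D \<in> generated_submonoid (reduced_affine_monoid fam m) (generators fam m)" for D
    using that by (induction rule: generated_submonoid.induct)
      (simp_all add: reduced_affine_monoid_def id generators_affine affine_diagram_compose)
  show ?thesis
    using assms per red
    by (cases var) (auto simp: affine_monoid_def reduced_affine_monoid_def affine_diagrams_affine)
qed

text \<open>Loops are never lost in an unreduced product, and the identity has none.\<close>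

lemma loops_unit:
  assumes D: "D \<in> carrier (diagram_monoid var fam m)"
    and DE: "D \<otimes>\<^bsub>diagram_monoid var fam m\<^esub> E = id_diagram m"
  shows "loops D = 0"
proof -
  have id: "loops (id_diagram m) = 0" by (simp add: id_diagram_eq_strands)
  have red: "loops D = 0" if "D \<in> generated_submonoid (reduced_affine_monoid fam m) (generators fam m)" for D
    using that by (induction rule: generated_submonoid.induct)
      (simp_all add: reduced_affine_monoid_def id generators_affine reduce_def)
  have aff: "loops D = 0" if "compose D E = id_diagram m"
  proof -
    have "loops (compose D E) = 0" using that id by simp
    then show ?thesis by (simp add: compose_def)
  qed
  show ?thesis
    using assms red aff by (cases var) (auto simp: affine_monoid_def reduced_affine_monoid_def)
qed

lemma unit_is_strands:
  assumes "D \<in> Units (diagram_monoid var fam m)"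
  obtains f where "bij f" "D = strands f" "\<And>i. f (i + int m) = f i + int m"
proof -
  let ?M = "diagram_monoid var fam m"
  obtain E where D: "D \<in> carrier ?M" and E: "E \<in> carrier ?M"
    and ED: "E \<otimes>\<^bsub>?M\<^esub> D = id_diagram m" and DE: "D \<otimes>\<^bsub>?M\<^esub> E = id_diagram m"
    using assms by (auto simp: Units_def diagram_monoid_simps)
  have "conn (compose D E) = conn (strands id)" "conn (compose E D) = conn (strands id)"
    using arg_cong[OF DE, of conn] arg_cong[OF ED, of conn]
    by (simp_all only: diagram_monoid_simps id_diagram_eq_strands)
  moreover have aff: "affine_diagram m D" "affine_diagram m E"
    using carrier_diagram_monoid_affine D E by blast+
  ultimately obtain f where f: "bij f" "conn D = conn (strands f)"
    using invertible_is_strands[OF equiv_conn_affine equiv_conn_affine] by blast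
  have "D = strands f"
    using f(2) loops_unit[OF D DE] by (cases D) (simp add: strands_def)
  then show ?thesis using that f aff affine_diagram_strands by blast
qed

lemma strands_mult_closed:
  assumes "strands f \<in> carrier (diagram_monoid var fam m)" "strands g \<in> carrier (diagram_monoid var fam m)"
    and "bij f" "bij g"
  shows "strands (g \<circ> f) \<in> carrier (diagram_monoid var fam m)"
proof -
  let ?M = "diagram_monoid var fam m"
  have aff: "strands (g \<circ> f) \<in> affine_diagrams fam m"
    if "strands f \<in> affine_diagrams fam m" "strands g \<in> affine_diagrams fam m"
    using that assms(3,4) bij_comp[OF assms(3,4)] by (simp add: strands_in_affine_diagrams strict_mono_def)
  have "strands f \<otimes>\<^bsub>?M\<^esub> strands g \<in> carrier ?M" if "var = Periodic \<or> var = Reduced_Periodic"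
    using that assms(1,2) by (auto intro: generated_submonoid.gen_mult)
  then show ?thesis
    using assms(1,2) aff diagram_monoid_simps(3)[where var = var and fam = fam and m = m and f = f and g = g]
    by (cases var) (auto simp: affine_monoid_def reduced_affine_monoid_def)
qed

lemma one_in_carrier: "id_diagram m \<in> carrier (diagram_monoid var fam m)"
proof -
  have "strands id \<in> affine_diagrams fam m"
    by (simp add: strands_in_affine_diagrams strict_mono_def)
  then have "id_diagram m \<in> affine_diagrams fam m" by (simp add: id_diagram_eq_strands)
  moreover have "id_diagram m \<in> generated_submonoid (affine_monoid fam m) (generators fam m)"
    using gen_one[of "affine_monoid fam m"] by (simp add: affine_monoid_def)
  moreover have "id_diagram m \<in> generated_submonoid (reduced_affine_monoid fam m) (generators fam m)"
    using gen_one[of "reduced_affine_monoid fam m"] by (simp add: reduced_affine_monoid_def)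
  moreover have "loops (id_diagram m) = 0" by (simp add: id_diagram_eq_strands)
  ultimately show ?thesis by (cases var) (auto simp: affine_monoid_def reduced_affine_monoid_def)
qed

lemma unit_inverse:
  assumes "strands f \<in> Units (diagram_monoid var fam m)"
  shows "strands (inv_into UNIV f) \<in> Units (diagram_monoid var fam m)"
proof -
  let ?M = "diagram_monoid var fam m"
  obtain E where E: "E \<in> carrier ?M" "E \<otimes>\<^bsub>?M\<^esub> strands f = id_diagram m" "strands f \<otimes>\<^bsub>?M\<^esub> E = id_diagram m"
    and f: "strands f \<in> carrier ?M"
    using assms by (auto simp: Units_def diagram_monoid_simps)
  then have "E \<in> Units ?M" by (auto simp: Units_def diagram_monoid_simps)
  then obtain g where g: "E = strands g" by (rule unit_is_strands)
  have "strands (g \<circ> f) = strands id" "strands (f \<circ> g) = strands id"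
    using E by (simp_all add: g diagram_monoid_simps id_diagram_eq_strands)
  then have "g \<circ> f = id" "f \<circ> g = id" using strands_inject by blast+
  then have "inv_into UNIV f = g" by (rule inv_unique_comp[rotated])
  then show ?thesis using \<open>E \<in> Units ?M\<close> g by simp
qed

lemma units_mult_closed:
  assumes "g \<in> Units (diagram_monoid var fam m)" "h \<in> Units (diagram_monoid var fam m)"
  shows "g \<otimes>\<^bsub>diagram_monoid var fam m\<^esub> h \<in> Units (diagram_monoid var fam m)"
proof -
  let ?M = "diagram_monoid var fam m"
  obtain a where a: "bij a" "g = strands a" using assms(1) by (rule unit_is_strands)
  obtain b where b: "bij b" "h = strands b" using assms(2) by (rule unit_is_strands)
  have inv: "strands (inv_into UNIV a) \<in> Units ?M" "strands (inv_into UNIV b) \<in> Units ?M"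
    using assms a b unit_inverse by blast+
  have "strands (b \<circ> a) \<in> carrier ?M"
    using assms a b by (intro strands_mult_closed) (auto simp: Units_def)
  moreover have "strands (inv_into UNIV a \<circ> inv_into UNIV b) \<in> carrier ?M"
    using inv a b by (intro strands_mult_closed) (auto simp: Units_def bij_imp_bij_inv)
  moreover have "(b \<circ> a) \<circ> (inv_into UNIV a \<circ> inv_into UNIV b) = id" "(inv_into UNIV a \<circ> inv_into UNIV b) \<circ> (b \<circ> a) = id"
    using a b by (auto simp: fun_eq_iff bij_def surj_f_inv_f)
  ultimately have "strands (b \<circ> a) \<in> Units ?M"
    unfolding Units_def by (auto simp: diagram_monoid_simps id_diagram_eq_strands intro!: bexI[of _ "strands (inv_into UNIV a \<circ> inv_into UNIV b)"])
  then show ?thesis by (simp add: a b diagram_monoid_simps)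
qed

text \<open>For a unit with strands \<open>f\<close>, the graph of the map that \<open>f\<close> induces on residues modulo \<open>m\<close>. Only
  finitely many values are possible.\<close>

definition residue_pairs :: "nat \<Rightarrow> diagram \<Rightarrow> (int \<times> int) set" where
  "residue_pairs m D = {(i mod int m, j mod int m) | i j. (Top i, Bot j) \<in> conn D}"

lemma shift_compatible_multiple:
  assumes "\<And>i. f (i + int m) = f i + int m"
  shows "f (i + int m * t) = f i + int m * t"
proof (induction t rule: int_induct[of _ 0])
  case (step1 t)
  then show ?case using assms[of "i + int m * t"] by (simp add: algebra_simps)
next
  case (step2 t)
  then show ?case using assms[of "i + int m * (t - 1)"] by (simp add: algebra_simps)
qed simp

text \<open>The units that induce the identity modulo \<open>m\<close> move every vertex by a multiple of \<open>m\<close>, and so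
  commute with one another. Two units with the same residue pairs differ by such a unit.\<close>

lemma virtually_commutative_units_diagram_monoid:
  assumes "m \<ge> 1"
  obtains T A where "virtually_commutative_units (diagram_monoid var fam m) T A"
proof -
  let ?M = "diagram_monoid var fam m"
  define A where "A = {strands f | f. strands f \<in> Units ?M \<and> (\<forall>i. f i mod int m = i mod int m)}"
  define rep where "rep r = (SOME g. g \<in> Units ?M \<and> residue_pairs m g = r)" for r
  define T where "T = rep ` residue_pairs m ` Units ?M"
  have rep: "rep (residue_pairs m g) \<in> Units ?M \<and> residue_pairs m (rep (residue_pairs m g)) = residue_pairs m g"
    if "g \<in> Units ?M" for g
    unfolding rep_def by (rule someI[of _ g]) (use that in simp)
  have "residue_pairs m g \<in> Pow ({0..<int m} \<times> {0..<int m})" for g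
    using assms by (auto simp: residue_pairs_def)
  then have "residue_pairs m ` Units ?M \<subseteq> Pow ({0..<int m} \<times> {0..<int m})" by blast
  then have "finite (residue_pairs m ` Units ?M)" by (rule finite_subset) simp
  then have "finite T" unfolding T_def by (rule finite_imageI)
  moreover have "T \<subseteq> Units ?M" using rep by (auto simp: T_def)
  moreover have "A \<subseteq> Units ?M" by (auto simp: A_def)
  moreover have "\<one>\<^bsub>?M\<^esub> \<in> Units ?M"
  proof -
    have "strands id \<in> carrier ?M" using one_in_carrier[of m var fam] by (simp add: id_diagram_eq_strands)
    then show ?thesis by (auto simp: Units_def diagram_monoid_simps id_diagram_eq_strands intro!: bexI[of _ "strands id"])
  qed
  moreover have "\<exists>t\<in>T. \<exists>a\<in>A. g = t \<otimes>\<^bsub>?M\<^esub> a" if g: "g \<in> Units ?M" for g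
  proof -
    define t where "t = rep (residue_pairs m g)"
    have t: "t \<in> Units ?M" "residue_pairs m t = residue_pairs m g" "t \<in> T"
      using rep[OF g] g by (auto simp: t_def T_def)
    obtain e where e: "bij e" "t = strands e" "\<And>i. e (i + int m) = e i + int m"
      using unit_is_strands[OF t(1)] by blast
    obtain f where f: "bij f" "g = strands f" using g by (rule unit_is_strands)
    have "f (inv_into UNIV e k) mod int m = k mod int m" for k
    proof -
      define i where "i = inv_into UNIV e k"
      have k: "k = e i" using e(1) by (simp add: i_def bij_def surj_f_inv_f)
      have "(i mod int m, f i mod int m) \<in> residue_pairs m g" by (force simp: residue_pairs_def f)
      then have "(i mod int m, f i mod int m) \<in> residue_pairs m t" using t by simp
      then obtain j where j: "i mod int m = j mod int m" "f i mod int m = e j mod int m"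
        by (auto simp: residue_pairs_def e(2))
      \<comment> \<open>equal residue pairs only provide some \<open>j\<close> congruent to \<open>i\<close>; periodicity of \<open>e\<close> makes up for
      the difference\<close>
      obtain s where "j = i + int m * s" using j(1) by (metis mod_eqE)
      then have "e j = e i + int m * s" using shift_compatible_multiple[of e m] e(3) by simp
      then have "f i mod int m = k mod int m" using j(2) k by simp
      then show ?thesis by (simp only: i_def)
    qed
    moreover have "strands (f \<circ> inv_into UNIV e) \<in> Units ?M"
      using units_mult_closed[OF unit_inverse g, of e] t e f by (simp add: diagram_monoid_simps)
    ultimately have "strands (f \<circ> inv_into UNIV e) \<in> A" by (auto simp: A_def)
    moreover have "g = t \<otimes>\<^bsub>?M\<^esub> strands (f \<circ> inv_into UNIV e)"
    proof -
      have "(f \<circ> inv_into UNIV e) \<circ> e = f" using e(1) by (auto simp: fun_eq_iff bij_def)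
      then show ?thesis by (simp add: e f diagram_monoid_simps)
    qed
    ultimately show ?thesis using t by blast
  qed
  moreover have "a \<otimes>\<^bsub>?M\<^esub> b = b \<otimes>\<^bsub>?M\<^esub> a" if ab: "a \<in> A" "b \<in> A" for a b
  proof -
    obtain f g where f: "a = strands f" "strands f \<in> Units ?M" "\<And>i. f i mod int m = i mod int m"
      and g: "b = strands g" "strands g \<in> Units ?M" "\<And>i. g i mod int m = i mod int m"
      using ab by (auto simp: A_def)
    have sf: "f (i + int m) = f i + int m" for i
      using unit_is_strands[OF f(2)] strands_inject by metis
    have sg: "g (i + int m) = g i + int m" for i
      using unit_is_strands[OF g(2)] strands_inject by metis
    have "f (g i) = g (f i)" for i
    proof -
      obtain s where s: "f i = i + int m * s" using f(3)[of i] by (metis mod_eqE)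
      obtain t where t: "g i = i + int m * t" using g(3)[of i] by (metis mod_eqE)
      have "f (g i) = f i + int m * t" unfolding t by (rule shift_compatible_multiple[of f, OF sf])
      moreover have "g (f i) = g i + int m * s" unfolding s by (rule shift_compatible_multiple[of g, OF sg])
      ultimately show ?thesis using s t by simp
    qed
    then have "f \<circ> g = g \<circ> f" by auto
    then show ?thesis by (simp add: f(1) g(1) diagram_monoid_simps)
  qed
  ultimately have "virtually_commutative_units ?M T A"
    using units_mult_closed unfolding virtually_commutative_units_def by blast
  then show ?thesis by (rule that)
qed

section \<open>Growth of the number of composition factors\<close>

theorem proposition4p3p3:
  fixes scale :: "'k::alg_closed_field \<Rightarrow> 'v::ab_group_add \<Rightarrow> 'v"
    and act :: "diagram \<Rightarrow> 'v \<Rightarrow> 'v"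
    and M :: "diagram monoid"
    and var :: variant and fam :: family and m :: nat
  assumes "m \<ge> 1"
    and "M = diagram_monoid var fam m"
    and "monoid_module M scale act"
    and "\<exists>B. finite_dimensional_vector_space scale B"
    and "\<forall>x\<in>carrier M - Units M. \<not> bij (act x)"
    and "inj_on act (Units M)"
  shows "(\<exists>C::real. C > 0 \<and>
            (\<forall>n. C * real (vector_space.dim scale (UNIV :: 'v set)) ^ n
                    \<le> real (tensor_length M scale act n) \<and>
                 real (tensor_length M scale act n)
                    \<le> real (vector_space.dim scale (UNIV :: 'v set)) ^ n)) \<and>
         (vector_space.dim scale (UNIV :: 'v set) > 0 \<longrightarrow>
            nonunit_zero_fraction M scale act \<longlonglongrightarrow> 1)"
proof -
  obtain B where B: "finite_dimensional_vector_space scale B" using assms(4) by blast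
  obtain T A where TA: "virtually_commutative_units M T A"
    using virtually_commutative_units_diagram_monoid[OF assms(1)] assms(2) by blast
  define d where "d = card B"
  have dim: "vector_space.dim scale (UNIV :: 'v set) = d"
    unfolding d_def by (rule finite_dimensional_vector_space.dim_UNIV[OF B])
  define good where "good n = card {i. Suc i < length (tensor_series M scale act n) \<and>
      (\<forall>x\<in>carrier M - Units M. tensor_act act x ` (tensor_series M scale act n ! Suc i)
        \<subseteq> tensor_series M scale act n ! i)}" for n
  define q where "q n = d * (d - 1) ^ n * (n + 1) ^ d" for n
  have nonunit: "\<not> bij (act x)" if "x \<in> carrier M - Units M" for x using assms(5) that by blast
  note counts = tensor_series_counts[OF assms(3) B nonunit TA, folded d_def, folded good_def q_def]
  have "real (tensor_length M scale act n) \<le> real d ^ n" for n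
    using counts(1)[of n] by (metis of_nat_le_iff of_nat_power)
  moreover have "(\<exists>C::real. C > 0 \<and> (\<forall>n. C * real d ^ n \<le> real (tensor_length M scale act n))) \<and>
      (d > 0 \<longrightarrow> nonunit_zero_fraction M scale act \<longlonglongrightarrow> 1)"
  proof (cases "d = 0")
    case True
    \<comment> \<open>only the tensor power of degree \<open>0\<close> is nonzero, and \<open>0 ^ 0 = 1\<close>\<close>
    have "1 * real d ^ n \<le> real (tensor_length M scale act n)" for n
      using counts(5)[of n] True by (cases n) auto
    then show ?thesis using True by (intro conjI exI[of _ 1]) auto
  next
    case False
    have "(\<lambda>n. real (q n) / real (d ^ n)) \<longlonglongrightarrow> 0"
      using exponential_beats_polynomial[of d] False by (simp add: q_def)
    note growth = growth_from_counts[of d q "card T" good "tensor_length M scale act", OF _ this counts(4,2,3,5)]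
    have "nonunit_zero_fraction M scale act = (\<lambda>n. real (good n) / real (tensor_length M scale act n))"
      by (simp add: nonunit_zero_fraction_def good_def Let_def fun_eq_iff)
    then show ?thesis using growth False by simp
  qed
  ultimately show ?thesis unfolding dim by blast
qed

end
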